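(* Let $G$ be the Baumslag-Remeslennikov group, a finitely presented soluble group. Then $G$ is not LERF, but $G$ does not contain a strictly ascending HNN extension of a polycyclic group (that is, no subgroup of $G$ is a strictly ascending HNN extension whose base is a polycyclic group).
   Context: A group is LERF (locally extended residually finite) if every finitely generated subgroup is an intersection of finite index subgroups. Given a group $B$ and an isomorphism $\theta$ from $B$ onto a subgroup $A$ of $B$, the ascending HNN extension $\langle t,B\rangle$ with base $B$ and stable letter $t$ is the group obtained from the free product $B*\langle t\rangle$ (with $t$ of infinite order) by adding the relations $tbt^{-1}=\theta(b)$ for all $b\in B$. It is strictly ascending if $A\neq B$, i.e. if $tBt^{-1}$ is a proper subgroup of $B$. A subgroup $H$ of a group $G$ is said to be a strictly ascending HNN extension with base $B$ and stable letter $t$ if $B\leq H$, $t\in H$, $H$ is generated by $t$ and $B$, $tBt^{-1}\subsetneq B$, and the natural map from the abstract ascending HNN extension of $B$ defined by $b\mapsto tbt^{-1}$ to $H$ is an isomorphism. A group "contains a strictly ascending HNN extension of a group of a certain type" if it has a subgroup that is a strictly ascending HNN extension whose base is of that type. The Baumslag-Remeslennikov group is defined as follows. Let $W=\mathbb{Z}\wr\mathbb{Z}=\mathbb{Z}^\infty\rtimes_\alpha\mathbb{Z}$, where $\mathbb{Z}^\infty$ is the free abelian group (written multiplicatively) on the generators $a_i$, $i\in\mathbb{Z}$, and the factor $\mathbb{Z}$ is generated by $s$ acting by $sa_is^{-1}=\alpha(a_i)=a_{i+1}$. Let $\theta:W\to W$ be the endomorphism with $\theta(s)=s$ and $\theta(a_i)=a_ia_{i+1}$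 for all $i\in\mathbb{Z}$; it is injective but not surjective. The Baumslag-Remeslennikov group is the strictly ascending HNN extension $G=\langle t,W\rangle$ with base $W$ and stable letter $t$, so that $twt^{-1}=\theta(w)$ for all $w\in W$. *)

theory Defs
  imports "HOL-Algebra.Free_Abelian_Groups" "HOL-Algebra.Solvable_Groups"
begin

section \<open>Free groups and presentations\<close>

text \<open>The letter \<open>(x, True)\<close> stands for the generator \<open>x\<close> and \<open>(x, False)\<close> for its inverse.
  Elements of the free group are the freely reduced words.\<close>

definition letter_inv :: "'a \<times> bool \<Rightarrow> 'a \<times> bool" where
  "letter_inv l = (fst l, \<not> snd l)"

definition reduced :: "('a \<times> bool) list \<Rightarrow> bool" where
  "reduced w \<longleftrightarrow> successively (\<lambda>l l'. l' \<noteq> letter_inv l) w"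

fun cons_reduce :: "'a \<times> bool \<Rightarrow> ('a \<times> bool) list \<Rightarrow> ('a \<times> bool) list" where
  "cons_reduce l [] = [l]"
| "cons_reduce l (l' # w) = (if l' = letter_inv l then w else l # l' # w)"

definition free_group :: "'a set \<Rightarrow> ('a \<times> bool) list monoid" where
  "free_group X =
    \<lparr>carrier = {w. reduced w \<and> set w \<subseteq> X \<times> UNIV},
     monoid.mult = (\<lambda>u v. foldr cons_reduce u v),
     one = []\<rparr>"

definition free_gen :: "'a \<Rightarrow> ('a \<times> bool) list" where
  "free_gen x = [(x, True)]"

definition normal_closure :: "('a, 'm) monoid_scheme \<Rightarrow> 'a set \<Rightarrow> 'a set" where
  "normal_closure G R = generate G {g \<otimes>\<^bsub>G\<^esub> r \<otimes>\<^bsub>G\<^esub> inv\<^bsub>G\<^esub> g |g r. g \<in> carrier G \<and> r \<in> R}"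

definition presented_group :: "'a set \<Rightarrow> ('a \<times> bool) list set \<Rightarrow> ('a \<times> bool) list set monoid" where
  "presented_group X R = free_group X Mod normal_closure (free_group X) R"

text \<open>Finite generating sets may be renamed, so taking generators in \<^typ>\<open>nat\<close> is no restriction.\<close>

definition finitely_presented :: "('a, 'm) monoid_scheme \<Rightarrow> bool" where
  "finitely_presented G \<longleftrightarrow>
    (\<exists>(X :: nat set) R. finite X \<and> finite R \<and> R \<subseteq> carrier (free_group X) \<and>
       G \<cong> presented_group X R)"


section \<open>Free products and ascending HNN extensions\<close>

text \<open>The free product is presented by the disjoint union of the multiplication tables.\<close>

definition free_product_rels ::
    "('a, 'm) monoid_scheme \<Rightarrow> ('b, 'n) monoid_scheme \<Rightarrow> (('a + 'b) \<times> bool) list set" where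
  "free_product_rels A B =
    (let F = free_group (Inl ` carrier A \<union> Inr ` carrier B) in
      {free_gen (Inl x) \<otimes>\<^bsub>F\<^esub> free_gen (Inl y) \<otimes>\<^bsub>F\<^esub> inv\<^bsub>F\<^esub> (free_gen (Inl (x \<otimes>\<^bsub>A\<^esub> y)))
         |x y. x \<in> carrier A \<and> y \<in> carrier A} \<union>
      {free_gen (Inr x) \<otimes>\<^bsub>F\<^esub> free_gen (Inr y) \<otimes>\<^bsub>F\<^esub> inv\<^bsub>F\<^esub> (free_gen (Inr (x \<otimes>\<^bsub>B\<^esub> y)))
         |x y. x \<in> carrier B \<and> y \<in> carrier B})"

definition free_product ::
    "('a, 'm) monoid_scheme \<Rightarrow> ('b, 'n) monoid_scheme \<Rightarrow> (('a + 'b) \<times> bool) list set monoid" where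
  "free_product A B = presented_group (Inl ` carrier A \<union> Inr ` carrier B) (free_product_rels A B)"

definition free_product_of ::
    "('a, 'm) monoid_scheme \<Rightarrow> ('b, 'n) monoid_scheme \<Rightarrow> 'a + 'b \<Rightarrow> (('a + 'b) \<times> bool) list set" where
  "free_product_of A B z =
    (let F = free_group (Inl ` carrier A \<union> Inr ` carrier B) in
      normal_closure F (free_product_rels A B) #>\<^bsub>F\<^esub> free_gen z)"

text \<open>Here \<open>\<theta>\<close> is meant to be an injective endomorphism of \<open>B\<close>, i.e. an isomorphism onto a
  subgroup of \<open>B\<close>. The stable letter is the generator \<open>1\<close> of the infinite cyclic free factor
  \<^const>\<open>integer_group\<close>.\<close>

definition hnn_rels ::
    "('a, 'm) monoid_scheme \<Rightarrow> ('a \<Rightarrow> 'a) \<Rightarrow> (('a + int) \<times> bool) list set set" where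
  "hnn_rels B \<theta> =
    (let P = free_product B integer_group;
         t = free_product_of B integer_group (Inr 1);
         \<iota> = (\<lambda>b. free_product_of B integer_group (Inl b))
     in {t \<otimes>\<^bsub>P\<^esub> \<iota> b \<otimes>\<^bsub>P\<^esub> inv\<^bsub>P\<^esub> t \<otimes>\<^bsub>P\<^esub> inv\<^bsub>P\<^esub> (\<iota> (\<theta> b)) |b. b \<in> carrier B})"

definition ascending_hnn ::
    "('a, 'm) monoid_scheme \<Rightarrow> ('a \<Rightarrow> 'a) \<Rightarrow> (('a + int) \<times> bool) list set set monoid" where
  "ascending_hnn B \<theta> =
    (let P = free_product B integer_group in P Mod normal_closure P (hnn_rels B \<theta>))"

definition hnn_base ::
    "('a, 'm) monoid_scheme \<Rightarrow> ('a \<Rightarrow> 'a) \<Rightarrow> 'a \<Rightarrow> (('a + int) \<times> bool) list set set" where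
  "hnn_base B \<theta> b =
    (let P = free_product B integer_group in
      normal_closure P (hnn_rels B \<theta>) #>\<^bsub>P\<^esub> free_product_of B integer_group (Inl b))"

definition hnn_stable ::
    "('a, 'm) monoid_scheme \<Rightarrow> ('a \<Rightarrow> 'a) \<Rightarrow> (('a + int) \<times> bool) list set set" where
  "hnn_stable B \<theta> =
    (let P = free_product B integer_group in
      normal_closure P (hnn_rels B \<theta>) #>\<^bsub>P\<^esub> free_product_of B integer_group (Inr 1))"

text \<open>The subgroup \<open>H\<close> of \<open>G\<close> is a strictly ascending HNN extension with base \<open>B\<close> and stable
  letter \<open>t\<close>. The abstract extension is generated by the images of \<open>B\<close> and the stable letter, so
  \<open>\<phi>\<close> below is uniquely determined: it is the natural map.\<close>

definition is_strictly_ascending_hnn ::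
    "('a, 'm) monoid_scheme \<Rightarrow> 'a set \<Rightarrow> 'a set \<Rightarrow> 'a \<Rightarrow> bool" where
  "is_strictly_ascending_hnn G H B t \<longleftrightarrow>
    subgroup H G \<and> subgroup B G \<and> B \<subseteq> H \<and> t \<in> H \<and> generate G (insert t B) = H \<and>
    (\<lambda>b. t \<otimes>\<^bsub>G\<^esub> b \<otimes>\<^bsub>G\<^esub> inv\<^bsub>G\<^esub> t) ` B \<subset> B \<and>
    (let \<theta> = (\<lambda>b. t \<otimes>\<^bsub>G\<^esub> b \<otimes>\<^bsub>G\<^esub> inv\<^bsub>G\<^esub> t); GB = G\<lparr>carrier := B\<rparr>; GH = G\<lparr>carrier := H\<rparr>
     in \<exists>\<phi> \<in> iso (ascending_hnn GB \<theta>) GH.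
          (\<forall>b\<in>B. \<phi> (hnn_base GB \<theta> b) = b) \<and> \<phi> (hnn_stable GB \<theta>) = t)"


section \<open>Polycyclic and LERF groups\<close>

inductive polycyclic_seq :: "('a, 'm) monoid_scheme \<Rightarrow> 'a set \<Rightarrow> bool" for G where
  unity: "polycyclic_seq G {\<one>\<^bsub>G\<^esub>}"
| extension: "\<lbrakk> polycyclic_seq G K; K \<lhd> (G\<lparr>carrier := H\<rparr>); subgroup H G;
                cyclic_group ((G\<lparr>carrier := H\<rparr>) Mod K) \<rbrakk> \<Longrightarrow> polycyclic_seq G H"

definition polycyclic :: "('a, 'm) monoid_scheme \<Rightarrow> bool" where
  "polycyclic G \<longleftrightarrow> polycyclic_seq G (carrier G)"

definition contains_strictly_ascending_hnn_of_polycyclic :: "('a, 'm) monoid_scheme \<Rightarrow> bool" where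
  "contains_strictly_ascending_hnn_of_polycyclic G \<longleftrightarrow>
    (\<exists>H B t. is_strictly_ascending_hnn G H B t \<and> polycyclic (G\<lparr>carrier := B\<rparr>))"

definition finite_index_subgroup :: "'a set \<Rightarrow> ('a, 'm) monoid_scheme \<Rightarrow> bool" where
  "finite_index_subgroup K G \<longleftrightarrow> subgroup K G \<and> finite (rcosets\<^bsub>G\<^esub> K)"

definition LERF :: "('a, 'm) monoid_scheme \<Rightarrow> bool" where
  "LERF G \<longleftrightarrow>
    (\<forall>S. finite S \<and> S \<subseteq> carrier G \<longrightarrow>
      (\<exists>\<K>. \<K> \<noteq> {} \<and> (\<forall>K\<in>\<K>. finite_index_subgroup K G) \<and> generate G S = \<Inter>\<K>))"


section \<open>The Baumslag-Remeslennikov group\<close>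

definition semidirect_product ::
    "('n, 'k) monoid_scheme \<Rightarrow> ('h, 'l) monoid_scheme \<Rightarrow> ('h \<Rightarrow> 'n \<Rightarrow> 'n) \<Rightarrow> ('n \<times> 'h) monoid" where
  "semidirect_product N H \<phi> =
    \<lparr>carrier = carrier N \<times> carrier H,
     monoid.mult = (\<lambda>(x, h) (y, k). (x \<otimes>\<^bsub>N\<^esub> \<phi> h y, h \<otimes>\<^bsub>H\<^esub> k)),
     one = (\<one>\<^bsub>N\<^esub>, \<one>\<^bsub>H\<^esub>)\<rparr>"

text \<open>The library's free abelian group is a multiplicative structure whose operation is
  addition of finitely supported functions; its generators \<open>a\<^sub>i\<close> are \<^term>\<open>frag_of i\<close>.
  The map \<open>shift n\<close> is the power \<open>\<alpha>\<^sup>n\<close> of the automorphism \<open>a\<^sub>i \<mapsto> a\<^bsub>i+1\<^esub>\<close>.\<close>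

definition shift :: "int \<Rightarrow> (int \<Rightarrow>\<^sub>0 int) \<Rightarrow> (int \<Rightarrow>\<^sub>0 int)" where
  "shift n = frag_extend (\<lambda>i. frag_of (i + n))"

definition Z_wr_Z :: "((int \<Rightarrow>\<^sub>0 int) \<times> int) monoid" where
  "Z_wr_Z = semidirect_product (free_Abelian_group UNIV) integer_group shift"

definition wr_a :: "int \<Rightarrow> (int \<Rightarrow>\<^sub>0 int) \<times> int" where
  "wr_a i = (frag_of i, 0)"

definition wr_s :: "(int \<Rightarrow>\<^sub>0 int) \<times> int" where
  "wr_s = (0, 1)"

definition br_endo :: "(int \<Rightarrow>\<^sub>0 int) \<times> int \<Rightarrow> (int \<Rightarrow>\<^sub>0 int) \<times> int" where
  "br_endo = (\<lambda>(x, n). (frag_extend (\<lambda>i. frag_of i + frag_of (i + 1)) x, n))"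

definition baumslag_remeslennikov where
  "baumslag_remeslennikov = ascending_hnn Z_wr_Z br_endo"


section \<open>Basic facts\<close>

lemma letter_inv_inv [simp]: "letter_inv (letter_inv l) = l"
  by (simp add: letter_inv_def)

lemma letter_inv_neq [simp]: "letter_inv l \<noteq> l" "l \<noteq> letter_inv l"
  by (auto simp: letter_inv_def prod_eq_iff)

lemma reduced_Cons: "reduced (l # w) \<longleftrightarrow> reduced w \<and> (w = [] \<or> hd w \<noteq> letter_inv l)"
  by (cases w) (auto simp: reduced_def)

lemma reduced_cons_reduce: "reduced w \<Longrightarrow> reduced (cons_reduce l w)"
proof (cases w)
  case (Cons l' w')
  assume "reduced w"
  with Cons show ?thesis by (auto simp: reduced_Cons)
qed (simp add: reduced_def)

lemma cons_reduce_inv: "reduced w \<Longrightarrow> cons_reduce l (cons_reduce (letter_inv l) w) = w"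
  by (cases w; cases "tl w") (auto simp: reduced_Cons)

lemma reduced_foldr: "reduced v \<Longrightarrow> reduced (foldr cons_reduce u v)"
  by (induction u) (auto simp: reduced_cons_reduce)

lemma foldr_cons_reduce:
  assumes "reduced z" "reduced w"
  shows "foldr cons_reduce (cons_reduce l z) w = cons_reduce l (foldr cons_reduce z w)"
proof (cases z)
  case (Cons l' z')
  have "cons_reduce l (cons_reduce (letter_inv l) (foldr cons_reduce z' w)) = foldr cons_reduce z' w"
    using assms by (intro cons_reduce_inv reduced_foldr)
  with Cons show ?thesis by auto
qed simp

lemma foldr_assoc:
  assumes "reduced v" "reduced w"
  shows "foldr cons_reduce (foldr cons_reduce u v) w = foldr cons_reduce u (foldr cons_reduce v w)"
  using assms by (induction u) (auto simp: foldr_cons_reduce reduced_foldr)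

lemma foldr_Nil: "reduced u \<Longrightarrow> foldr cons_reduce u [] = u"
proof (induction u)
  case (Cons l u)
  then show ?case by (cases u) (auto simp: reduced_Cons)
qed simp

lemma set_foldr: "set (foldr cons_reduce u v) \<subseteq> set u \<union> set v"
proof (induction u)
  case (Cons l u)
  have "set (cons_reduce l w) \<subseteq> insert l (set w)" for w
    by (cases w) auto
  with Cons show ?case by fastforce
qed simp

lemma foldr_left_inverse:
  "reduced v \<Longrightarrow> foldr cons_reduce (map letter_inv (rev u)) (foldr cons_reduce u v) = v"
proof (induction u arbitrary: v)
  case (Cons l u)
  have "cons_reduce (letter_inv l) (cons_reduce l (foldr cons_reduce u v)) = foldr cons_reduce u v"
    using cons_reduce_inv[of "foldr cons_reduce u v" "letter_inv l"] reduced_foldr[OF Cons.prems]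
    by simp
  with Cons show ?case by simp
qed simp

lemma group_free_group: "group (free_group X)"
proof (rule groupI)
  fix x assume x: "x \<in> carrier (free_group X)"
  define y where "y = foldr cons_reduce (map letter_inv (rev x)) []"
  have "set (map letter_inv (rev x)) \<subseteq> X \<times> UNIV"
    using x by (fastforce simp: free_group_def letter_inv_def)
  hence y: "y \<in> carrier (free_group X)"
    using set_foldr[of "map letter_inv (rev x)" "[]"]
    by (auto simp: free_group_def y_def reduced_foldr reduced_def[of "[]"])
  have red: "reduced ([] :: ('a \<times> bool) list)" by (simp add: reduced_def)
  have "foldr cons_reduce y x = foldr cons_reduce (map letter_inv (rev x)) (foldr cons_reduce [] x)"
    unfolding y_def by (rule foldr_assoc) (use x red in \<open>auto simp: free_group_def\<close>)
  also have "\<dots> = []"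
    using foldr_left_inverse[OF red, of x] x by (simp add: foldr_Nil free_group_def)
  finally show "\<exists>y\<in>carrier (free_group X). y \<otimes>\<^bsub>free_group X\<^esub> x = \<one>\<^bsub>free_group X\<^esub>"
    using y by (auto simp: free_group_def)
next
  fix x y assume "x \<in> carrier (free_group X)" "y \<in> carrier (free_group X)"
  then show "x \<otimes>\<^bsub>free_group X\<^esub> y \<in> carrier (free_group X)"
    using set_foldr[of x y] by (auto simp: free_group_def reduced_foldr)
qed (auto simp: free_group_def foldr_assoc reduced_def[of "[]"])

lemma (in group) normal_closure_normal:
  assumes "R \<subseteq> carrier G"
  shows "normal_closure G R \<lhd> G"
  unfolding normal_closure_def
proof (rule normal_generateI)
  show "{g \<otimes> r \<otimes> inv g |g r. g \<in> carrier G \<and> r \<in> R} \<subseteq> carrier G"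
    using assms by auto
next
  fix h g assume "h \<in> {g \<otimes> r \<otimes> inv g |g r. g \<in> carrier G \<and> r \<in> R}" and g: "g \<in> carrier G"
  then obtain k r where k: "k \<in> carrier G" "r \<in> R" "h = k \<otimes> r \<otimes> inv k" by auto
  with g assms have "g \<otimes> h \<otimes> inv g = (g \<otimes> k) \<otimes> r \<otimes> inv (g \<otimes> k)"
    by (simp add: subset_iff inv_mult_group m_assoc)
  with k g show "g \<otimes> h \<otimes> inv g \<in> {g \<otimes> r \<otimes> inv g |g r. g \<in> carrier G \<and> r \<in> R}"
    by blast
qed

lemma group_presented_group:
  "R \<subseteq> carrier (free_group X) \<Longrightarrow> group (presented_group X R)"
  unfolding presented_group_def
  by (intro normal.factorgroup_is_group group.normal_closure_normal group_free_group)

lemma free_gen_carrier: "x \<in> X \<Longrightarrow> free_gen x \<in> carrier (free_group X)"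
  by (simp add: free_gen_def free_group_def reduced_def)

lemma free_product_rels_carrier:
  assumes "group A" "group B"
  shows "free_product_rels A B \<subseteq> carrier (free_group (Inl ` carrier A \<union> Inr ` carrier B))"
proof -
  interpret F: group "free_group (Inl ` carrier A \<union> Inr ` carrier B)" by (rule group_free_group)
  interpret A: group A by fact
  interpret B: group B by fact
  show ?thesis
    by (auto simp: free_product_rels_def Let_def intro!: free_gen_carrier F.m_closed F.inv_closed)
qed

lemma group_free_product: "group A \<Longrightarrow> group B \<Longrightarrow> group (free_product A B)"
  unfolding free_product_def
  by (intro group_presented_group free_product_rels_carrier)

lemma free_product_of_carrier:
  assumes "z \<in> Inl ` carrier A \<union> Inr ` carrier B"
  shows "free_product_of A B z \<in> carrier (free_product A B)"
  using free_gen_carrier[OF assms]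
  by (auto simp: free_product_of_def free_product_def presented_group_def Let_def
      carrier_FactGroup)

lemma hnn_rels_carrier:
  assumes "group B" "\<theta> \<in> carrier B \<rightarrow> carrier B"
  shows "hnn_rels B \<theta> \<subseteq> carrier (free_product B integer_group)"
proof -
  interpret P: group "free_product B integer_group"
    using assms by (intro group_free_product) auto
  show ?thesis
    using assms(2)
    by (auto simp: hnn_rels_def Let_def
        intro!: free_product_of_carrier P.m_closed P.inv_closed)
qed

lemma group_ascending_hnn:
  assumes "group B" "\<theta> \<in> carrier B \<rightarrow> carrier B"
  shows "group (ascending_hnn B \<theta>)"
  unfolding ascending_hnn_def Let_def
  using assms
  by (intro normal.factorgroup_is_group group.normal_closure_normal group_free_product
      hnn_rels_carrier) auto

lemma shift_0 [simp]: "shift 0 x = x"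
  using frag_expansion[of x] by (simp add: shift_def)

lemma shift_zero [simp]: "shift n 0 = 0"
  by (simp add: shift_def)

lemma shift_frag_of [simp]: "shift n (frag_of i) = frag_of (i + n)"
  by (simp add: shift_def)

lemma shift_add: "shift n (x + y) = shift n x + shift n y"
  by (simp add: shift_def frag_extend_add)

lemma shift_shift: "shift m (shift n x) = shift (m + n) x"
  using frag_extend_compose[of "\<lambda>i. frag_of (i + m)" "\<lambda>i. i + n" x]
  by (simp add: shift_def o_def ac_simps)

lemma carrier_Z_wr_Z [simp]: "carrier Z_wr_Z = UNIV"
  by (auto simp: Z_wr_Z_def semidirect_product_def free_Abelian_group_def integer_group_def)

lemma mult_Z_wr_Z [simp]: "(x, m) \<otimes>\<^bsub>Z_wr_Z\<^esub> (y, n) = (x + shift m y, m + n)"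
  by (simp add: Z_wr_Z_def semidirect_product_def free_Abelian_group_def integer_group_def)

lemma one_Z_wr_Z [simp]: "\<one>\<^bsub>Z_wr_Z\<^esub> = (0, 0)"
  by (simp add: Z_wr_Z_def semidirect_product_def free_Abelian_group_def integer_group_def)

lemma group_Z_wr_Z: "group Z_wr_Z"
proof (rule groupI)
  fix x :: "(int \<Rightarrow>\<^sub>0 int) \<times> int"
  obtain f n where [simp]: "x = (f, n)" by (cases x)
  show "\<exists>y\<in>carrier Z_wr_Z. y \<otimes>\<^bsub>Z_wr_Z\<^esub> x = \<one>\<^bsub>Z_wr_Z\<^esub>"
    by (rule bexI[of _ "(- shift (- n) f, - n)"]) auto
qed (auto simp: shift_add shift_shift add.assoc)

lemma wr_conj: "wr_s \<otimes>\<^bsub>Z_wr_Z\<^esub> wr_a i \<otimes>\<^bsub>Z_wr_Z\<^esub> inv\<^bsub>Z_wr_Z\<^esub> wr_s = wr_a (i + 1)"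
proof -
  interpret group Z_wr_Z by (rule group_Z_wr_Z)
  have "inv\<^bsub>Z_wr_Z\<^esub> wr_s = (0, -1)"
    by (rule inv_equality) (auto simp: wr_s_def)
  then show ?thesis by (simp add: wr_s_def wr_a_def)
qed

lemma br_endo_shift:
  "frag_extend (\<lambda>i. frag_of i + frag_of (i + 1)) x = x + shift 1 x"
proof -
  have "frag_extend (\<lambda>i. frag_of i + frag_of (i + 1)) x = frag_extend frag_of x + shift 1 x"
    unfolding shift_def by (simp add: frag_extend_def frag_cmul_distrib2 sum.distrib)
  then show ?thesis by (simp flip: frag_expansion)
qed

lemma br_endo_eq: "br_endo (x, n) = (x + shift 1 x, n)"
  by (simp add: br_endo_def br_endo_shift)

lemma br_endo_hom: "br_endo \<in> hom Z_wr_Z Z_wr_Z"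
  by (auto simp: hom_def br_endo_eq shift_add shift_shift ac_simps)

lemma br_endo_inj: "inj br_endo"
proof (rule injI)
  fix u v :: "(int \<Rightarrow>\<^sub>0 int) \<times> int"
  assume eq: "br_endo u = br_endo v"
  have zero: "x = 0" if "x + shift 1 x = 0" for x
  proof (rule ccontr)
    assume "x \<noteq> 0"
    define m where "m = Max (Poly_Mapping.keys x)"
    have m: "m \<in> Poly_Mapping.keys x" "\<And>i. i \<in> Poly_Mapping.keys x \<Longrightarrow> i \<le> m"
      using \<open>x \<noteq> 0\<close> by (auto simp: m_def)
    have "Poly_Mapping.lookup (shift 1 x) (m + 1) =
        (\<Sum>i\<in>Poly_Mapping.keys x. if i = m then Poly_Mapping.lookup x i else 0)"
      unfolding shift_def frag_extend_def Poly_Mapping.lookup_sum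
      by (intro sum.cong) auto
    also have "\<dots> = Poly_Mapping.lookup x m"
      using m(1) by simp
    finally have "Poly_Mapping.lookup (x + shift 1 x) (m + 1) = Poly_Mapping.lookup x m"
      using m(2)[of "m + 1"] by (auto simp: Poly_Mapping.lookup_add in_keys_iff)
    with that m(1) show False by (simp add: in_keys_iff)
  qed
  obtain x m y n where [simp]: "u = (x, m)" "v = (y, n)" by (cases u; cases v)
  have "(x - y) + shift 1 (x - y) = 0"
    using eq by (simp add: br_endo_eq shift_def frag_extend_diff algebra_simps)
  with zero[of "x - y"] eq show "u = v" by (simp add: br_endo_eq)
qed

lemma br_endo_not_surj: "\<not> surj br_endo"
proof
  assume "surj br_endo"
  then obtain x n where "br_endo (x, n) = (frag_of 0, 0)"
    by (metis surj_def surj_pair)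
  then have x: "x + shift 1 x = frag_of 0" by (simp add: br_endo_eq)
  define e where "e = (\<lambda>y :: int \<Rightarrow>\<^sub>0 int. Poly_Mapping.lookup (frag_extend (\<lambda>_. frag_of ()) y) ())"
  have "e (shift 1 x) = e x"
    using frag_extend_compose[of "\<lambda>_. frag_of ()" "\<lambda>i. i + 1" x]
    by (simp add: e_def shift_def o_def)
  moreover have "e (x + shift 1 x) = e x + e (shift 1 x)"
    by (simp add: e_def frag_extend_add Poly_Mapping.lookup_add)
  moreover have "e (frag_of 0) = 1" unfolding e_def frag_extend_of by simp
  ultimately have "2 * e x = 1" using x by simp
  then show False by presburger
qed

lemma br_endo_gens:
  "br_endo wr_s = wr_s" "br_endo (wr_a i) = wr_a i \<otimes>\<^bsub>Z_wr_Z\<^esub> wr_a (i + 1)"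
  by (auto simp: br_endo_eq wr_s_def wr_a_def)

lemma group_baumslag_remeslennikov: "group baumslag_remeslennikov"
  unfolding baumslag_remeslennikov_def
  using br_endo_hom by (intro group_ascending_hnn group_Z_wr_Z) (auto simp: hom_def)

end

theory Submission
  imports Defs "HOL-Computational_Algebra.Polynomial_Factorial"
begin

text \<open>Let \<open>K\<close> be the fraction field of \<open>\<int>[X]\<close>, and let \<open>(i, j) \<in> \<int>\<^sup>2\<close> act on \<open>K\<close> as multiplication by
  \<open>X\<^sup>i (1 + X)\<^sup>j\<close>. Suppose that a group is generated by \<open>a, s, t\<close> with \<open>[s, t] = [a, sas\<inverse>] = 1\<close> and
  \<open>tat\<inverse> = a sas\<inverse>\<close>, and maps to \<open>K \<rtimes> \<int>\<^sup>2\<close> by sending \<open>a, s, t\<close> to \<open>1 \<in> K\<close> and the two basis vectors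
  of \<open>\<int>\<^sup>2\<close>. Conjugation by \<open>t\<close> forces all conjugates \<open>s\<^sup>i a s\<^bsup>-i\<^esup>\<close> to commute, so every element has the
  form \<open>t\<^sup>m w t\<^sup>l\<close> with \<open>w\<close> in the image of \<open>\<int> \<wr> \<int>\<close>, and the map is injective. Both \<open>G\<close> and the group
  presented by these three relations qualify, so they are isomorphic, and \<open>G\<close> is metabelian.

  If \<open>W = \<langle>a, s\<rangle>\<close> lies in a subgroup \<open>L\<close> of finite index, then \<open>t\<^sup>n \<in> L\<close> for some \<open>n > 0\<close>, and
  \<open>t\<inverse>wt = t\<^bsup>-n\<^esup> (t\<^bsup>n-1\<^esup> w t\<^bsup>1-n\<^esup>) t\<^sup>n \<in> L\<close> for all \<open>w \<in> W\<close>; since \<open>t\<inverse>Wt\<close> is not contained in \<open>W\<close>, \<open>G\<close> is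
  not LERF.

  If \<open>B\<close> is polycyclic and \<open>hBh\<inverse> \<subset> B\<close>, then \<open>N = B \<inter> K\<close> is finitely generated, and as \<open>\<int>\<^sup>2\<close> is
  abelian also \<open>hNh\<inverse> \<subset> N\<close>. On \<open>N\<close>, \<open>h\<close> acts as multiplication by some \<open>u = X\<^sup>i (1 + X)\<^sup>j\<close>. The elements of
  \<open>N\<close> have a common denominator and bounded degree, so comparing orders at \<open>0\<close> and \<open>-1\<close> and degrees
  in \<open>u\<^sup>k z \<in> N\<close> for all \<open>k\<close> gives \<open>i, j \<ge> 0\<close> and \<open>i + j \<le> 0\<close>. So \<open>u = 1\<close> and \<open>hNh\<inverse> = N\<close>, a
  contradiction.\<close>

section \<open>Universal properties\<close>

lemma (in group_hom) normal_closure_universal: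
  assumes "R \<subseteq> carrier G" "\<And>r. r \<in> R \<Longrightarrow> h r = \<one>\<^bsub>H\<^esub>"
  obtains g where "g \<in> hom (G Mod normal_closure G R) H"
    "\<And>x. x \<in> carrier G \<Longrightarrow> g (normal_closure G R #> x) = h x"
proof -
  have "normal_closure G R \<subseteq> kernel G H h"
    unfolding normal_closure_def
    by (rule G.generate_subgroup_incl[OF _ subgroup_kernel]) (use assms in \<open>auto simp: kernel_def subset_iff\<close>)
  with G.normal_closure_normal[OF assms(1)] that show thesis
    by (rule_tac FactGroup_universal_kernel) auto
qed

lemma (in group) normal_closure_rcos_eq_one:
  assumes "R \<subseteq> carrier G" "r \<in> R"
  shows "normal_closure G R #> r = \<one>\<^bsub>G Mod normal_closure G R\<^esub>"
proof -
  interpret N: normal "normal_closure G R" G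
    using assms by (intro normal_closure_normal)
  have "r = \<one> \<otimes> r \<otimes> inv \<one>" using assms by auto
  then have "r \<in> normal_closure G R"
    unfolding normal_closure_def using assms by (intro generate.incl) blast
  then show ?thesis by (simp add: N.rcos_const is_group)
qed

lemma (in normal) generate_FactGroup:
  assumes "S \<subseteq> carrier G" "generate G S = carrier G"
  shows "generate (G Mod H) ((\<lambda>x. H #> x) ` S) = carrier (G Mod H)"
proof -
  interpret q: group_hom G "G Mod H" "\<lambda>x. H #> x"
    by (intro group_hom.intro group_hom_axioms.intro factorgroup_is_group r_coset_hom_Mod is_group)
  show ?thesis
    using q.generate_img[OF assms(1)] assms(2) by (simp add: carrier_FactGroup)
qed

section \<open>Evaluation of words, free groups and presented groups\<close>

definition word_val :: "('b, 'm) monoid_scheme \<Rightarrow> ('a \<Rightarrow> 'b) \<Rightarrow> ('a \<times> bool) list \<Rightarrow> 'b" where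
  "word_val G f w =
    foldr (\<lambda>l y. (if snd l then f (fst l) else inv\<^bsub>G\<^esub> f (fst l)) \<otimes>\<^bsub>G\<^esub> y) w \<one>\<^bsub>G\<^esub>"

context group
begin

lemma word_val_Nil [simp]: "word_val G f [] = \<one>"
  and word_val_Cons [simp]:
    "word_val G f (l # w) = (if snd l then f (fst l) else inv f (fst l)) \<otimes> word_val G f w"
  by (simp_all add: word_val_def)

lemma word_val_closed:
  "f \<in> X \<rightarrow> carrier G \<Longrightarrow> set w \<subseteq> X \<times> UNIV \<Longrightarrow> word_val G f w \<in> carrier G"
  by (induction w) (auto simp: Pi_iff)

text \<open>\<open>word_val\<close> is defined on all words, so it can be compared before and after
  a cancellation: a cancelled pair contributes an element times its inverse. This makes evaluation
  multiplicative although the product of the free group reduces words.\<close>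

lemma word_val_cons_reduce:
  assumes "f \<in> X \<rightarrow> carrier G" "l \<in> X \<times> UNIV" "set w \<subseteq> X \<times> UNIV"
  shows "word_val G f (cons_reduce l w) = word_val G f (l # w)"
proof (cases w)
  case (Cons l' w')
  with assms have c: "f (fst l) \<in> carrier G" "word_val G f w' \<in> carrier G"
    by (auto intro: word_val_closed)
  with Cons show ?thesis
    by (auto simp: letter_inv_def inv_solve_left simp flip: m_assoc)
qed simp

lemma word_val_foldr:
  assumes "f \<in> X \<rightarrow> carrier G" "set u \<subseteq> X \<times> UNIV" "set v \<subseteq> X \<times> UNIV"
  shows "word_val G f (foldr cons_reduce u v) = word_val G f u \<otimes> word_val G f v"
  using assms(2)
proof (induction u)
  case (Cons l u)
  have "set (foldr cons_reduce u v) \<subseteq> X \<times> UNIV"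
    using set_foldr[of u v] Cons.prems assms(3) by auto
  then have "word_val G f (foldr cons_reduce (l # u) v) = word_val G f (l # foldr cons_reduce u v)"
    using word_val_cons_reduce[OF assms(1)] Cons.prems by simp
  with Cons show ?case
    using assms word_val_closed[of f X u] word_val_closed[of f X v]
    by (auto simp: Pi_iff m_assoc)
qed (use assms word_val_closed[of f X v] in auto)

lemma free_group_universal:
  assumes "f \<in> X \<rightarrow> carrier G"
  obtains h where "h \<in> hom (free_group X) G" "\<And>x. x \<in> X \<Longrightarrow> h (free_gen x) = f x"
proof
  show "word_val G f \<in> hom (free_group X) G"
    using assms by (auto simp: hom_def free_group_def word_val_foldr word_val_closed)
  show "word_val G f (free_gen x) = f x" if "x \<in> X" for x
    using that assms by (auto simp: free_gen_def Pi_iff)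
qed

end

lemma inv_free_gen:
  assumes "x \<in> X"
  shows "inv\<^bsub>free_group X\<^esub> (free_gen x) = [(x, False)]"
proof -
  interpret group "free_group X" by (rule group_free_group)
  show ?thesis
    by (rule inv_equality)
      (use assms in \<open>auto simp: free_group_def free_gen_def reduced_def letter_inv_def\<close>)
qed

lemma generate_free_group: "generate (free_group X) (free_gen ` X) = carrier (free_group X)"
proof -
  interpret group "free_group X" by (rule group_free_group)
  have "w \<in> generate (free_group X) (free_gen ` X)"
    if "reduced w" "set w \<subseteq> X \<times> UNIV" for w
    using that
  proof (induction w)
    case Nil
    then show ?case using generate.one[of "free_group X"] by (simp add: free_group_def)
  next
    case (Cons l w)
    obtain x b where l: "l = (x, b)" by (cases l)
    have "[l] \<in> generate (free_group X) (free_gen ` X)"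
    proof (cases b)
      case True
      then show ?thesis using l Cons.prems by (auto simp: free_gen_def intro!: generate.incl)
    next
      case False
      then show ?thesis
        using l Cons.prems generate.inv[of "free_gen x" "free_gen ` X" "free_group X"]
        by (auto simp: inv_free_gen)
    qed
    moreover have "w \<in> generate (free_group X) (free_gen ` X)"
      using Cons by (auto simp: reduced_Cons)
    ultimately have "[l] \<otimes>\<^bsub>free_group X\<^esub> w \<in> generate (free_group X) (free_gen ` X)"
      by (rule generate.eng)
    moreover have "[l] \<otimes>\<^bsub>free_group X\<^esub> w = l # w"
      using Cons.prems by (cases w) (auto simp: free_group_def reduced_Cons)
    ultimately show ?case by simp
  qed
  moreover have "generate (free_group X) (free_gen ` X) \<subseteq> carrier (free_group X)"
    by (rule generate_incl) (auto intro: free_gen_carrier)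
  ultimately show ?thesis by (auto simp: free_group_def)
qed

definition presented_gen :: "'a set \<Rightarrow> ('a \<times> bool) list set \<Rightarrow> 'a \<Rightarrow> ('a \<times> bool) list set" where
  "presented_gen X R x = normal_closure (free_group X) R #>\<^bsub>free_group X\<^esub> free_gen x"

lemma presented_gen_carrier: "x \<in> X \<Longrightarrow> presented_gen X R x \<in> carrier (presented_group X R)"
  by (auto simp: presented_gen_def presented_group_def carrier_FactGroup free_gen_carrier)

text \<open>The relator condition is stated for every homomorphism extending \<open>f\<close>, so
  that it can be checked by the homomorphism laws alone, without reference to
  \<open>word_val\<close>.\<close>

lemma (in group) presented_group_universal:
  assumes "R \<subseteq> carrier (free_group X)" "f \<in> X \<rightarrow> carrier G"
    and "\<And>h r. \<lbrakk>group_hom (free_group X) G h; \<And>x. x \<in> X \<Longrightarrow> h (free_gen x) = f x; r \<in> R\<rbrakk> \<Longrightarrow> h r = \<one>"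
  obtains h where "h \<in> hom (presented_group X R) G" "\<And>x. x \<in> X \<Longrightarrow> h (presented_gen X R x) = f x"
proof -
  obtain h where h: "h \<in> hom (free_group X) G" "\<And>x. x \<in> X \<Longrightarrow> h (free_gen x) = f x"
    using free_group_universal[OF assms(2)] by metis
  interpret h: group_hom "free_group X" G h
    using h(1) by (simp add: group_hom_def group_hom_axioms_def group_free_group is_group)
  obtain g where "g \<in> hom (free_group X Mod normal_closure (free_group X) R) G"
    "\<And>x. x \<in> carrier (free_group X) \<Longrightarrow> g (normal_closure (free_group X) R #>\<^bsub>free_group X\<^esub> x) = h x"
    using h.normal_closure_universal[OF assms(1) assms(3)[OF h.group_hom_axioms h(2)]] by metis
  with that h(2) show thesis by (auto simp: presented_group_def presented_gen_def free_gen_carrier)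
qed

lemma generate_presented_group:
  assumes "R \<subseteq> carrier (free_group X)"
  shows "generate (presented_group X R) (presented_gen X R ` X) = carrier (presented_group X R)"
proof -
  interpret normal "normal_closure (free_group X) R" "free_group X"
    by (rule group.normal_closure_normal[OF group_free_group assms])
  show ?thesis
    using generate_FactGroup[of "free_gen ` X"]
    by (simp add: generate_free_group image_subset_iff free_gen_carrier
        presented_group_def presented_gen_def image_image)
qed

lemma presented_group_hom:
  assumes "R \<subseteq> carrier (free_group X)"
  shows "group_hom (free_group X) (presented_group X R)
    (\<lambda>w. normal_closure (free_group X) R #>\<^bsub>free_group X\<^esub> w)"
proof -
  interpret normal "normal_closure (free_group X) R" "free_group X"
    by (rule group.normal_closure_normal[OF group_free_group assms])
  show ?thesis
    unfolding presented_group_def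
    by (intro group_hom.intro group_hom_axioms.intro factorgroup_is_group r_coset_hom_Mod is_group)
qed

lemma presented_group_relator:
  assumes "R \<subseteq> carrier (free_group X)" "r \<in> R"
  shows "normal_closure (free_group X) R #>\<^bsub>free_group X\<^esub> r = \<one>\<^bsub>presented_group X R\<^esub>"
  using group.normal_closure_rcos_eq_one[OF group_free_group assms] by (simp add: presented_group_def)

section \<open>Free products\<close>

lemma free_product_of_eq:
  "free_product_of A B z = presented_gen (Inl ` carrier A \<union> Inr ` carrier B) (free_product_rels A B) z"
  by (simp add: free_product_of_def presented_gen_def Let_def)

lemma free_product_of_hom:
  assumes "group A" "group B"
  shows "(\<lambda>x. free_product_of A B (Inl x)) \<in> hom A (free_product A B)"
    and "(\<lambda>y. free_product_of A B (Inr y)) \<in> hom B (free_product A B)"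
proof -
  define X where "X = Inl ` carrier A \<union> Inr ` carrier B"
  define R where "R = free_product_rels A B"
  interpret A: group A by fact
  interpret B: group B by fact
  have R: "R \<subseteq> carrier (free_group X)"
    unfolding R_def X_def by (rule free_product_rels_carrier[OF assms])
  interpret q: group_hom "free_group X" "presented_group X R"
    "\<lambda>w. normal_closure (free_group X) R #>\<^bsub>free_group X\<^esub> w"
    by (rule presented_group_hom[OF R])
  \<comment> \<open>Every entry of a multiplication table is a relator of this shape; its triviality
    in the quotient is the homomorphism law.\<close>
  have *: "presented_gen X R c = presented_gen X R a \<otimes>\<^bsub>presented_group X R\<^esub> presented_gen X R b"
    if "a \<in> X" "b \<in> X" "c \<in> X"
      "free_gen a \<otimes>\<^bsub>free_group X\<^esub> free_gen b \<otimes>\<^bsub>free_group X\<^esub> inv\<^bsub>free_group X\<^esub> free_gen c \<in> R"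
    for a b c
    using presented_group_relator[OF R that(4)] that(1-3)
      free_gen_carrier[of a X] free_gen_carrier[of b X] free_gen_carrier[of c X]
      presented_gen_carrier[of a X R] presented_gen_carrier[of b X R] presented_gen_carrier[of c X R]
    by (simp add: presented_gen_def q.H.inv_solve_right')
  have "free_gen (Inl x) \<otimes>\<^bsub>free_group X\<^esub> free_gen (Inl y) \<otimes>\<^bsub>free_group X\<^esub>
      inv\<^bsub>free_group X\<^esub> free_gen (Inl (x \<otimes>\<^bsub>A\<^esub> y)) \<in> R" if "x \<in> carrier A" "y \<in> carrier A" for x y
    using that by (auto simp: R_def X_def free_product_rels_def Let_def)
  then show "(\<lambda>x. free_product_of A B (Inl x)) \<in> hom A (free_product A B)"
    unfolding free_product_of_eq free_product_def X_def[symmetric] R_def[symmetric]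
    by (intro homI presented_gen_carrier *) (auto simp: X_def)
  have "free_gen (Inr x) \<otimes>\<^bsub>free_group X\<^esub> free_gen (Inr y) \<otimes>\<^bsub>free_group X\<^esub>
      inv\<^bsub>free_group X\<^esub> free_gen (Inr (x \<otimes>\<^bsub>B\<^esub> y)) \<in> R" if "x \<in> carrier B" "y \<in> carrier B" for x y
    using that by (auto simp: R_def X_def free_product_rels_def Let_def)
  then show "(\<lambda>y. free_product_of A B (Inr y)) \<in> hom B (free_product A B)"
    unfolding free_product_of_eq free_product_def X_def[symmetric] R_def[symmetric]
    by (intro homI presented_gen_carrier *) (auto simp: X_def)
qed

lemma (in group) free_product_universal:
  assumes "group A" "group B" "\<alpha> \<in> hom A G" "\<beta> \<in> hom B G"
  obtains h where "h \<in> hom (free_product A B) G"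
    "\<And>x. x \<in> carrier A \<Longrightarrow> h (free_product_of A B (Inl x)) = \<alpha> x"
    "\<And>y. y \<in> carrier B \<Longrightarrow> h (free_product_of A B (Inr y)) = \<beta> y"
proof -
  define X where "X = Inl ` carrier A \<union> Inr ` carrier B"
  interpret A: group A by fact
  interpret B: group B by fact
  have f: "case_sum \<alpha> \<beta> \<in> X \<rightarrow> carrier G"
    using assms(3,4) by (auto simp: X_def hom_def)
  have "h r = \<one>"
    if h: "group_hom (free_group X) G h" "\<And>x. x \<in> X \<Longrightarrow> h (free_gen x) = case_sum \<alpha> \<beta> x"
      and r: "r \<in> free_product_rels A B" for h r
  proof -
    interpret h: group_hom "free_group X" G h by (rule h(1))
    have mem: "x \<in> carrier A \<Longrightarrow> Inl x \<in> X" "y \<in> carrier B \<Longrightarrow> Inr y \<in> X" for x y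
      by (auto simp: X_def)
    have c: "x \<in> carrier A \<Longrightarrow> \<alpha> x \<in> carrier G" "y \<in> carrier B \<Longrightarrow> \<beta> y \<in> carrier G" for x y
      using assms(3,4) by (auto simp: hom_def)
    show ?thesis
      using r by (auto simp: free_product_rels_def Let_def simp flip: X_def
          simp: mem free_gen_carrier h(2) hom_mult[OF assms(3)] hom_mult[OF assms(4)] c)
  qed
  then obtain h where "h \<in> hom (presented_group X (free_product_rels A B)) G"
    "\<And>x. x \<in> X \<Longrightarrow> h (presented_gen X (free_product_rels A B) x) = case_sum \<alpha> \<beta> x"
    using presented_group_universal[OF free_product_rels_carrier[OF assms(1,2), folded X_def] f] by metis
  with that[of h] show thesis
    by (auto simp: free_product_def free_product_of_eq X_def)
qed

lemma generate_free_product: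
  assumes "group A" "group B"
  shows "generate (free_product A B) (free_product_of A B ` (Inl ` carrier A \<union> Inr ` carrier B)) =
    carrier (free_product A B)"
  using generate_presented_group[OF free_product_rels_carrier[OF assms]]
  unfolding free_product_def free_product_of_eq .

section \<open>Ascending HNN extensions: relation, generators and universal property\<close>

locale hnn_data = B: group B for B :: "('a, 'm) monoid_scheme" +
  fixes \<theta> :: "'a \<Rightarrow> 'a"
  assumes \<theta>_closed: "\<theta> \<in> carrier B \<rightarrow> carrier B"
begin

abbreviation "P \<equiv> free_product B integer_group"
abbreviation "q w \<equiv> normal_closure P (hnn_rels B \<theta>) #>\<^bsub>P\<^esub> w"

sublocale P: group P
  by (rule group_free_product) (simp_all add: B.is_group)

sublocale N: normal "normal_closure P (hnn_rels B \<theta>)" P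
  by (rule P.normal_closure_normal[OF hnn_rels_carrier]) (simp_all add: B.is_group \<theta>_closed)

sublocale G: group "ascending_hnn B \<theta>"
  by (rule group_ascending_hnn) (simp_all add: B.is_group \<theta>_closed)

lemma quot_hom: "group_hom P (ascending_hnn B \<theta>) q"
  unfolding ascending_hnn_def Let_def
  by (intro group_hom.intro group_hom_axioms.intro N.factorgroup_is_group N.r_coset_hom_Mod P.is_group)

sublocale q: group_hom P "ascending_hnn B \<theta>" q
  by (rule quot_hom)

lemma inl_hom: "(\<lambda>b. free_product_of B integer_group (Inl b)) \<in> hom B P"
  and inr_hom: "(\<lambda>n. free_product_of B integer_group (Inr n)) \<in> hom integer_group P"
  by (simp_all add: free_product_of_hom B.is_group)

lemma hnn_base_eq: "hnn_base B \<theta> b = q (free_product_of B integer_group (Inl b))"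
  and hnn_stable_eq: "hnn_stable B \<theta> = q (free_product_of B integer_group (Inr 1))"
  by (simp_all add: hnn_base_def hnn_stable_def Let_def)

lemma hnn_base_hom: "hnn_base B \<theta> \<in> hom B (ascending_hnn B \<theta>)"
  using hom_compose[OF inl_hom q.homh] by (simp add: o_def hnn_base_eq[abs_def])

sublocale base: group_hom B "ascending_hnn B \<theta>" "hnn_base B \<theta>"
  by unfold_locales (rule hnn_base_hom)

lemma hnn_stable_closed: "hnn_stable B \<theta> \<in> carrier (ascending_hnn B \<theta>)"
  by (auto simp: hnn_stable_eq free_product_of_carrier)

lemma hnn_relation:
  assumes b: "b \<in> carrier B"
  shows "hnn_stable B \<theta> \<otimes>\<^bsub>ascending_hnn B \<theta>\<^esub> hnn_base B \<theta> b \<otimes>\<^bsub>ascending_hnn B \<theta>\<^esub>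
    inv\<^bsub>ascending_hnn B \<theta>\<^esub> hnn_stable B \<theta> = hnn_base B \<theta> (\<theta> b)"
proof -
  let ?t = "free_product_of B integer_group (Inr 1)"
  let ?i = "\<lambda>b. free_product_of B integer_group (Inl b)"
  have c: "?t \<in> carrier P" "?i b \<in> carrier P" "?i (\<theta> b) \<in> carrier P"
    using \<theta>_closed b by (auto intro!: free_product_of_carrier)
  have "?t \<otimes>\<^bsub>P\<^esub> ?i b \<otimes>\<^bsub>P\<^esub> inv\<^bsub>P\<^esub> ?t \<otimes>\<^bsub>P\<^esub> inv\<^bsub>P\<^esub> ?i (\<theta> b) \<in> hnn_rels B \<theta>"
    using b by (auto simp: hnn_rels_def Let_def)
  from P.normal_closure_rcos_eq_one[OF hnn_rels_carrier this]
  have "q (?t \<otimes>\<^bsub>P\<^esub> ?i b \<otimes>\<^bsub>P\<^esub> inv\<^bsub>P\<^esub> ?t \<otimes>\<^bsub>P\<^esub> inv\<^bsub>P\<^esub> ?i (\<theta> b)) = \<one>\<^bsub>ascending_hnn B \<theta>\<^esub>"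
    by (simp add: B.is_group \<theta>_closed ascending_hnn_def Let_def)
  then show ?thesis
    using c by (simp add: hnn_base_eq hnn_stable_eq G.inv_solve_right')
qed

lemma generate_hnn:
  "generate (ascending_hnn B \<theta>) (insert (hnn_stable B \<theta>) (hnn_base B \<theta> ` carrier B)) =
    carrier (ascending_hnn B \<theta>)" (is "generate ?G ?S = _")
proof -
  let ?X = "Inl ` carrier B \<union> Inr ` carrier integer_group"
  have S: "?S \<subseteq> carrier ?G"
    using hnn_stable_closed by auto
  interpret H: subgroup "generate ?G ?S" ?G
    by (rule G.generate_is_subgroup[OF S])
  have "carrier ?G = generate ?G (q ` free_product_of B integer_group ` ?X)"
    using N.generate_FactGroup[OF _ generate_free_product[of B integer_group]]
    by (simp add: image_subset_iff free_product_of_carrier B.is_group ascending_hnn_def Let_def)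
  also have "\<dots> \<subseteq> generate ?G ?S"
  proof (rule G.generate_subgroup_incl[OF _ H.subgroup_axioms])
    \<comment> \<open>The free product has one generator for every integer \<open>n\<close>. In the
      cyclic factor it is the \<open>n\<close>-th power of the generator for \<open>1\<close>, so
      the stable letter suffices.\<close>
    have "q (free_product_of B integer_group (Inr n)) \<in> generate ?G ?S" for n
    proof -
      have "(\<lambda>n. q (free_product_of B integer_group (Inr n))) \<in> hom integer_group ?G"
        using hom_compose[OF inr_hom q.homh] by (simp add: o_def)
      then interpret z: group_hom integer_group ?G "\<lambda>n. q (free_product_of B integer_group (Inr n))"
        by (simp add: group_hom_def group_hom_axioms_def G.is_group)
      have "q (free_product_of B integer_group (Inr n)) = hnn_stable B \<theta> [^]\<^bsub>?G\<^esub> n"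
        using z.hom_int_pow[of 1 n] by (simp add: hnn_stable_eq)
      also have "\<dots> \<in> generate ?G ?S"
        by (intro G.subgroup_int_pow_closed[OF H.subgroup_axioms] generate.incl) auto
      finally show ?thesis .
    qed
    moreover have "q (free_product_of B integer_group (Inl b)) \<in> generate ?G ?S" if "b \<in> carrier B" for b
      using that by (intro generate.incl) (simp flip: hnn_base_eq)
    ultimately show "q ` free_product_of B integer_group ` ?X \<subseteq> generate ?G ?S"
      by blast
  qed
  finally show ?thesis
    using H.subset by blast
qed

lemma hnn_universal:
  assumes "group Q" "\<beta> \<in> hom B Q" "\<tau> \<in> carrier Q"
    and rel: "\<And>b. b \<in> carrier B \<Longrightarrow> \<tau> \<otimes>\<^bsub>Q\<^esub> \<beta> b \<otimes>\<^bsub>Q\<^esub> inv\<^bsub>Q\<^esub> \<tau> = \<beta> (\<theta> b)"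
  obtains h where "h \<in> hom (ascending_hnn B \<theta>) Q"
    "\<And>b. b \<in> carrier B \<Longrightarrow> h (hnn_base B \<theta> b) = \<beta> b" "h (hnn_stable B \<theta>) = \<tau>"
proof -
  interpret Q: group Q by fact
  interpret \<beta>: group_hom B Q \<beta> by unfold_locales fact
  \<comment> \<open>The cyclic factor is mapped by the powers of \<open>\<tau>\<close>. Together
    with \<open>\<beta>\<close> this defines a map on the free product, and \<open>rel\<close> says
    that it kills \<open>hnn_rels\<close>.\<close>
  have "(\<lambda>n::int. \<tau> [^]\<^bsub>Q\<^esub> n) \<in> hom integer_group Q"
    using assms(3) by (auto simp: hom_def Q.int_pow_mult)
  then obtain h where h: "h \<in> hom P Q"
    "\<And>b. b \<in> carrier B \<Longrightarrow> h (free_product_of B integer_group (Inl b)) = \<beta> b"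
    "\<And>n. n \<in> carrier integer_group \<Longrightarrow> h (free_product_of B integer_group (Inr n)) = \<tau> [^]\<^bsub>Q\<^esub> n"
    using Q.free_product_universal[OF B.is_group group_integer_group assms(2)] by blast
  interpret h: group_hom P Q h by unfold_locales fact
  have "h r = \<one>\<^bsub>Q\<^esub>" if "r \<in> hnn_rels B \<theta>" for r
  proof -
    obtain b where b: "b \<in> carrier B" and
      r: "r = free_product_of B integer_group (Inr 1) \<otimes>\<^bsub>P\<^esub> free_product_of B integer_group (Inl b)
        \<otimes>\<^bsub>P\<^esub> inv\<^bsub>P\<^esub> free_product_of B integer_group (Inr 1)
        \<otimes>\<^bsub>P\<^esub> inv\<^bsub>P\<^esub> free_product_of B integer_group (Inl (\<theta> b))"
      using \<open>r \<in> _\<close> by (auto simp: hnn_rels_def Let_def)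
    have "\<theta> b \<in> carrier B" using b \<theta>_closed by auto
    with b show ?thesis
      using rel[OF b] assms(3) by (simp add: r h free_product_of_carrier)
  qed
  then obtain g where "g \<in> hom (P Mod normal_closure P (hnn_rels B \<theta>)) Q"
    "\<And>w. w \<in> carrier P \<Longrightarrow> g (q w) = h w"
    using h.normal_closure_universal[OF hnn_rels_carrier[OF B.is_group \<theta>_closed]] by metis
  with that[of g] h assms(3) show thesis
    by (simp add: ascending_hnn_def Let_def hnn_base_eq hnn_stable_eq free_product_of_carrier)
qed

end

section \<open>The affine group over the rational functions\<close>

type_synonym ratfun = "int poly fract"

definition fract_X :: ratfun where "fract_X = to_fract [:0, 1:]"

definition unit_fract :: "int \<Rightarrow> int \<Rightarrow> ratfun" where
  "unit_fract i j = fract_X powi i * (1 + fract_X) powi j"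

lemma fract_X_neq_0 [simp]: "fract_X \<noteq> 0" "1 + fract_X \<noteq> 0"
proof -
  have "1 + fract_X = to_fract [:1, 1:]"
    unfolding fract_X_def to_fract_1[symmetric] to_fract_add[symmetric] by (simp add: one_pCons)
  then show "fract_X \<noteq> 0" "1 + fract_X \<noteq> 0" by (auto simp: fract_X_def)
qed

lemma unit_fract_0_0 [simp]: "unit_fract 0 0 = 1"
  and unit_fract_1_0 [simp]: "unit_fract 1 0 = fract_X"
  and unit_fract_0_1 [simp]: "unit_fract 0 1 = 1 + fract_X"
  and unit_fract_neq_0 [simp]: "unit_fract i j \<noteq> 0"
  by (simp_all add: unit_fract_def)

lemma unit_fract_add: "unit_fract (i + i') (j + j') = unit_fract i j * unit_fract i' j'"
  by (simp add: unit_fract_def power_int_add)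

text \<open>The triple \<open>(m, i, j)\<close> stands for the affine map
  \<open>z \<mapsto> unit_fract i j * z + m\<close>, and the product is composition.\<close>

definition affine_model :: "(ratfun \<times> int \<times> int) monoid" where
  "affine_model = \<lparr>carrier = UNIV,
     monoid.mult = (\<lambda>(m, i, j) (m', i', j'). (m + unit_fract i j * m', i + i', j + j')),
     one = (0, 0, 0)\<rparr>"

lemma carrier_affine_model [simp]: "carrier affine_model = UNIV"
  and mult_affine_model [simp]:
    "(m, i, j) \<otimes>\<^bsub>affine_model\<^esub> (m', i', j') = (m + unit_fract i j * m', i + i', j + j')"
  and one_affine_model [simp]: "\<one>\<^bsub>affine_model\<^esub> = (0, 0, 0)"
  by (simp_all add: affine_model_def)

lemma unit_fract_minus: "unit_fract (- i) (- j) * unit_fract i j = 1"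
  by (simp flip: unit_fract_add)

lemma group_affine_model: "group affine_model"
proof (rule groupI)
  fix x :: "ratfun \<times> int \<times> int"
  obtain m i j where [simp]: "x = (m, i, j)" by (cases x)
  show "\<exists>y\<in>carrier affine_model. y \<otimes>\<^bsub>affine_model\<^esub> x = \<one>\<^bsub>affine_model\<^esub>"
    by (rule bexI[of _ "(- unit_fract (- i) (- j) * m, - i, - j)"]) auto
qed (auto simp: unit_fract_add algebra_simps)

lemma inv_affine_model [simp]:
  "inv\<^bsub>affine_model\<^esub> (m, i, j) = (- unit_fract (- i) (- j) * m, - i, - j)"
  by (rule group.inv_equality[OF group_affine_model]) auto

section \<open>Laurent polynomials: finitely supported functions evaluated at
  \<open>fract_X\<close>, and the embedding of \<open>Z_wr_Z\<close>\<close>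

definition laurent_eval :: "(int \<Rightarrow>\<^sub>0 int) \<Rightarrow> ratfun" where
  "laurent_eval f = (\<Sum>i\<in>Poly_Mapping.keys f. of_int (Poly_Mapping.lookup f i) * fract_X powi i)"

lemma laurent_eval_0 [simp]: "laurent_eval 0 = 0"
  by (simp add: laurent_eval_def)

lemma laurent_eval_frag_of [simp]: "laurent_eval (frag_of i) = fract_X powi i"
  by (simp add: laurent_eval_def)

text \<open>The simplifier rewrites \<open>frag_of 0\<close> to the unit \<open>1\<close> of the ring of finitely supported functions.\<close>

lemma laurent_eval_1 [simp]: "laurent_eval 1 = 1"
  using laurent_eval_frag_of[of 0] by simp

lemma laurent_eval_add: "laurent_eval (f + g) = laurent_eval f + laurent_eval g"
  unfolding laurent_eval_def
  by (rule Poly_Mapping.setsum_keys_plus_distrib) (simp_all add: algebra_simps)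

lemma laurent_eval_diff: "laurent_eval (f - g) = laurent_eval f - laurent_eval g"
  using laurent_eval_add[of "f - g" g] by simp

lemma laurent_eval_shift: "laurent_eval (shift n f) = fract_X powi n * laurent_eval f"
proof (induction f rule: frag_induction[OF subset_UNIV, case_names zero one diff])
  case (diff a b)
  then show ?case
    by (simp add: shift_def frag_extend_diff laurent_eval_diff algebra_simps)
qed (auto simp: power_int_add mult.commute)

lemma of_int_fract: "(of_int c :: ratfun) = to_fract [:c:]"
proof -
  have "(of_nat n :: ratfun) = to_fract (of_nat n)" for n
    by (induction n) auto
  then have "(of_int c :: ratfun) = to_fract (of_int c)"
    by (cases c) auto
  then show ?thesis by (simp add: of_int_poly)
qed

lemma fract_X_power: "fract_X ^ n = to_fract (monom 1 n)"
proof (induction n)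
  case (Suc n)
  have "[:0, 1:] * monom 1 n = (monom 1 (Suc n) :: int poly)"
    by (simp add: monom_Suc)
  with Suc show ?case by (simp add: fract_X_def flip: to_fract_mult)
qed auto

text \<open>For nonzero \<open>f\<close>, dividing by the least power of \<open>fract_X\<close> that
  occurs leaves a genuine polynomial \<open>p\<close>, whose constant coefficient is the nonzero
  lowest coefficient of \<open>f\<close>.\<close>

lemma laurent_eval_eq_0: "laurent_eval f = 0 \<longleftrightarrow> f = 0"
proof
  assume 0: "laurent_eval f = 0"
  show "f = 0"
  proof (rule ccontr)
    assume "f \<noteq> 0"
    define K where "K = Poly_Mapping.keys f"
    define N where "N = Min K"
    have K: "finite K" "K \<noteq> {}" using \<open>f \<noteq> 0\<close> by (auto simp: K_def)
    then have N: "N \<in> K" "\<And>i. i \<in> K \<Longrightarrow> N \<le> i" by (auto simp: N_def)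
    define p where "p = (\<Sum>i\<in>K. monom (Poly_Mapping.lookup f i) (nat (i - N)))"
    have "to_fract p = (\<Sum>i\<in>K. to_fract (monom (Poly_Mapping.lookup f i) (nat (i - N))))"
      unfolding p_def using K(1) by (induction rule: finite_induct) auto
    also have "\<dots> = (\<Sum>i\<in>K. fract_X powi (- N) * (of_int (Poly_Mapping.lookup f i) * fract_X powi i))"
    proof (intro sum.cong refl)
      fix i assume "i \<in> K"
      have "to_fract (monom (Poly_Mapping.lookup f i) (nat (i - N))) =
          of_int (Poly_Mapping.lookup f i) * fract_X ^ nat (i - N)"
        by (simp add: of_int_fract fract_X_power smult_monom flip: to_fract_mult)
      also have "fract_X ^ nat (i - N) = fract_X powi (- N + i)"
        using N(2)[OF \<open>i \<in> K\<close>] by (simp add: power_int_def)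
      finally show "to_fract (monom (Poly_Mapping.lookup f i) (nat (i - N))) =
          fract_X powi (- N) * (of_int (Poly_Mapping.lookup f i) * fract_X powi i)"
        by (subst (asm) power_int_add) (simp_all add: mult_ac)
    qed
    also have "\<dots> = fract_X powi (- N) * laurent_eval f"
      by (simp add: laurent_eval_def K_def sum_distrib_left)
    finally have "p = 0" using 0 by simp
    have "coeff p 0 = (\<Sum>i\<in>K. if i = N then Poly_Mapping.lookup f i else 0)"
      unfolding p_def coeff_sum by (intro sum.cong) (use N in force)+
    also have "\<dots> = Poly_Mapping.lookup f N" using K N by simp
    finally show False using \<open>p = 0\<close> N(1) by (simp add: K_def in_keys_iff)
  qed
qed simp

definition wr_model :: "(int \<Rightarrow>\<^sub>0 int) \<times> int \<Rightarrow> ratfun \<times> int \<times> int" where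
  "wr_model = (\<lambda>(f, n). (laurent_eval f, n, 0))"

lemma wr_model_hom: "wr_model \<in> hom Z_wr_Z affine_model"
  by (auto simp: hom_def wr_model_def laurent_eval_add laurent_eval_shift unit_fract_def)

lemma wr_model_inj: "inj wr_model"
proof (rule injI)
  fix u v assume "wr_model u = wr_model v"
  then show "u = v"
    using laurent_eval_eq_0[of "fst u - fst v"]
    by (auto simp: wr_model_def laurent_eval_diff split: prod.splits)
qed

text \<open>On Laurent polynomials \<open>br_endo\<close> is multiplication by
  \<open>1 + fract_X\<close>, which is how \<open>(0, 0, 1)\<close> acts. This is the hypothesis
  needed to extend \<open>wr_model\<close> from the base to the HNN extension.\<close>

lemma wr_model_br_endo:
  "(0, 0, 1) \<otimes>\<^bsub>affine_model\<^esub> wr_model w \<otimes>\<^bsub>affine_model\<^esub> inv\<^bsub>affine_model\<^esub> (0, 0, 1) =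
    wr_model (br_endo w)"
  by (cases w) (simp add: wr_model_def br_endo_eq laurent_eval_add laurent_eval_shift algebra_simps)

lemma generate_Z_wr_Z: "generate Z_wr_Z {wr_a 0, wr_s} = UNIV"
proof -
  interpret W: group Z_wr_Z by (rule group_Z_wr_Z)
  let ?H = "generate Z_wr_Z {wr_a 0, wr_s}"
  interpret H: subgroup ?H Z_wr_Z by (rule W.generate_is_subgroup) simp
  have inv: "inv\<^bsub>Z_wr_Z\<^esub> (f, n) = (- shift (- n) f, - n)" for f n
    by (rule W.inv_equality) auto
  have pow: "wr_s [^]\<^bsub>Z_wr_Z\<^esub> n = (0, int n)" for n :: nat
    by (induction n) (auto simp: wr_s_def)
  have s: "(0, n) \<in> ?H" for n
  proof -
    have "wr_s [^]\<^bsub>Z_wr_Z\<^esub> n \<in> ?H"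
      by (intro W.subgroup_int_pow_closed[OF H.subgroup_axioms] generate.incl) auto
    then show ?thesis by (cases "n \<ge> 0") (auto simp: int_pow_def2 pow inv)
  qed
  have a: "(frag_of i, 0) \<in> ?H" for i
  proof -
    have "(frag_of 0, 0) \<in> ?H" by (rule generate.incl) (simp add: wr_a_def)
    then have "(0, i) \<otimes>\<^bsub>Z_wr_Z\<^esub> (frag_of 0, 0) \<otimes>\<^bsub>Z_wr_Z\<^esub> (0, - i) \<in> ?H"
      by (intro H.m_closed s)
    \<comment> \<open>Unfolding precedes simplification because the latter would turn
      \<open>frag_of 0\<close> into \<open>1\<close>, to which \<open>shift_frag_of\<close> does not
      apply.\<close>
    then show ?thesis
      unfolding mult_Z_wr_Z shift_frag_of by simp
  qed
  have f: "(f, 0) \<in> ?H" for f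
  proof (induction f rule: frag_induction[OF subset_UNIV, case_names zero one diff])
    case (diff a b)
    have "(a, 0) \<otimes>\<^bsub>Z_wr_Z\<^esub> inv\<^bsub>Z_wr_Z\<^esub> (b, 0) \<in> ?H"
      using diff by (intro H.m_closed H.m_inv_closed)
    then show ?case by (simp add: inv)
  qed (use s[of 0] a in auto)
  have "(f, n) \<in> ?H" for f n
    using H.m_closed[OF f s, of f n] by simp
  then show ?thesis by auto
qed

section \<open>Normal forms\<close>

lemma (in group) centralizer_subgroup:
  assumes "S \<subseteq> carrier G"
  shows "subgroup {y \<in> carrier G. \<forall>x\<in>S. x \<otimes> y = y \<otimes> x} G"
proof (rule subgroupI)
  fix y assume y: "y \<in> {y \<in> carrier G. \<forall>x\<in>S. x \<otimes> y = y \<otimes> x}"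
  have "x \<otimes> inv y = inv y \<otimes> x" if "x \<in> S" for x
  proof -
    have "x \<in> carrier G" "y \<in> carrier G" "x \<otimes> y = y \<otimes> x" using that y assms by auto
    then have "y \<otimes> (x \<otimes> inv y) = x" by (simp flip: m_assoc) (simp add: m_assoc \<open>x \<otimes> y = y \<otimes> x\<close>[symmetric])
    then show ?thesis using \<open>x \<in> carrier G\<close> \<open>y \<in> carrier G\<close> by (simp add: inv_solve_left)
  qed
  with y show "inv y \<in> {y \<in> carrier G. \<forall>x\<in>S. x \<otimes> y = y \<otimes> x}" by simp
next
  fix y z
  assume y: "y \<in> {y \<in> carrier G. \<forall>x\<in>S. x \<otimes> y = y \<otimes> x}"
    and z: "z \<in> {y \<in> carrier G. \<forall>x\<in>S. x \<otimes> y = y \<otimes> x}"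
  have "x \<otimes> (y \<otimes> z) = y \<otimes> z \<otimes> x" if "x \<in> S" for x
  proof -
    have "x \<in> carrier G" using that assms by auto
    then have "x \<otimes> (y \<otimes> z) = (x \<otimes> y) \<otimes> z" using y z by (simp add: m_assoc)
    also have "\<dots> = y \<otimes> (x \<otimes> z)" using that y z \<open>x \<in> carrier G\<close> by (simp add: m_assoc)
    also have "\<dots> = y \<otimes> z \<otimes> x" using that y z \<open>x \<in> carrier G\<close> by (simp add: m_assoc)
    finally show ?thesis .
  qed
  with y z show "y \<otimes> z \<in> {y \<in> carrier G. \<forall>x\<in>S. x \<otimes> y = y \<otimes> x}" by simp
next
  have "\<one> \<in> {y \<in> carrier G. \<forall>x\<in>S. x \<otimes> y = y \<otimes> x}"
    using assms by auto
  then show "{y \<in> carrier G. \<forall>x\<in>S. x \<otimes> y = y \<otimes> x} \<noteq> {}"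
    by blast
qed auto

text \<open>Centralizers are used twice: that of \<open>S\<close> contains \<open>S\<close>, hence
  all of \<open>generate G S\<close>; so \<open>S\<close> centralizes \<open>generate G S\<close>,
  and then \<open>generate G S\<close> does too.\<close>

lemma (in group) generate_commute:
  assumes S: "S \<subseteq> carrier G" and comm: "\<And>x y. x \<in> S \<Longrightarrow> y \<in> S \<Longrightarrow> x \<otimes> y = y \<otimes> x"
    and "x \<in> generate G S" "y \<in> generate G S"
  shows "x \<otimes> y = y \<otimes> x"
proof -
  have "generate G S \<subseteq> {y \<in> carrier G. \<forall>x\<in>S. x \<otimes> y = y \<otimes> x}"
    by (rule generate_subgroup_incl[OF _ centralizer_subgroup[OF S]]) (use S comm in auto)
  then have "S \<subseteq> {x \<in> carrier G. \<forall>y\<in>generate G S. y \<otimes> x = x \<otimes> y}"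
    using S by auto
  then have "generate G S \<subseteq> {x \<in> carrier G. \<forall>y\<in>generate G S. y \<otimes> x = x \<otimes> y}"
    by (rule generate_subgroup_incl[OF _ centralizer_subgroup[OF generate_incl[OF S]]])
  with assms show ?thesis by auto
qed

definition (in group) conjugate :: "'a \<Rightarrow> 'a \<Rightarrow> 'a" where
  "conjugate g x = g \<otimes> x \<otimes> inv g"

context group
begin

lemma conjugate_closed [simp]: "g \<in> carrier G \<Longrightarrow> x \<in> carrier G \<Longrightarrow> conjugate g x \<in> carrier G"
  by (simp add: conjugate_def)

lemma conjugate_one [simp]: "x \<in> carrier G \<Longrightarrow> conjugate \<one> x = x"
  by (simp add: conjugate_def)

lemma conjugate_mult_arg:
  "g \<in> carrier G \<Longrightarrow> x \<in> carrier G \<Longrightarrow> y \<in> carrier G \<Longrightarrow> conjugate g (x \<otimes> y) = conjugate g x \<otimes> conjugate g y"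
  by (simp add: conjugate_def m_assoc) (simp add: m_assoc[symmetric])

lemma conjugate_conjugate:
  "g \<in> carrier G \<Longrightarrow> h \<in> carrier G \<Longrightarrow> x \<in> carrier G \<Longrightarrow> conjugate g (conjugate h x) = conjugate (g \<otimes> h) x"
  by (simp add: conjugate_def inv_mult_group m_assoc)

lemma conjugate_hom: "g \<in> carrier G \<Longrightarrow> conjugate g \<in> hom G G"
  by (auto simp: hom_def conjugate_mult_arg)

lemma conjugate_mult_left: "g \<in> carrier G \<Longrightarrow> x \<in> carrier G \<Longrightarrow> conjugate g x \<otimes> g = g \<otimes> x"
  by (simp add: conjugate_def m_assoc)

lemma conjugate_eq_iff: "g \<in> carrier G \<Longrightarrow> x \<in> carrier G \<Longrightarrow> conjugate g x = x \<longleftrightarrow> g \<otimes> x = x \<otimes> g"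
  by (simp add: conjugate_def inv_solve_right')

text \<open>Conjugating \<open>[a\<^sub>0, a\<^sub>n] = 1\<close> by \<open>t\<close> gives \<open>[a\<^sub>0 a\<^sub>1, a\<^sub>n a\<^bsub>n+1\<^esub>] = 1\<close>; this lemma then
  extracts \<open>[a\<^sub>0, a\<^bsub>n+1\<^esub>] = 1\<close>.\<close>

lemma commute_step:
  assumes c: "p \<in> carrier G" "q \<in> carrier G" "r \<in> carrier G" "z \<in> carrier G"
    and "(p \<otimes> q) \<otimes> (r \<otimes> z) = (r \<otimes> z) \<otimes> (p \<otimes> q)"
    and "q \<otimes> r = r \<otimes> q" "q \<otimes> z = z \<otimes> q" "p \<otimes> r = r \<otimes> p"
  shows "p \<otimes> z = z \<otimes> p"
proof -
  have "r \<otimes> (z \<otimes> p) \<otimes> q = (r \<otimes> z) \<otimes> (p \<otimes> q)" using c by (simp add: m_assoc)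
  also have "\<dots> = p \<otimes> (q \<otimes> r) \<otimes> z" unfolding assms(5)[symmetric] using c by (simp add: m_assoc)
  also have "\<dots> = (p \<otimes> r) \<otimes> (q \<otimes> z)" unfolding assms(6) using c by (simp add: m_assoc)
  also have "\<dots> = r \<otimes> (p \<otimes> z) \<otimes> q" unfolding assms(7,8) using c by (simp add: m_assoc)
  finally show ?thesis using c by simp
qed

end

section \<open>Groups with generators \<open>a\<close>, \<open>s\<close>, \<open>t\<close>
  satisfying the three relations\<close>

lemma free_Abelian_hom_eqI:
  assumes "group_hom (free_Abelian_group UNIV) H h" "group_hom (free_Abelian_group UNIV) H k"
    and eq: "\<And>i. h (frag_of i) = k (frag_of i)"
  shows "h x = k x"
proof -
  interpret h: group_hom "free_Abelian_group UNIV" H h by fact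
  interpret k: group_hom "free_Abelian_group UNIV" H k by fact
  show ?thesis
  proof (induction x rule: frag_induction[OF subset_UNIV, case_names zero one diff])
    case zero
    then show ?case using h.hom_one k.hom_one by simp
  next
    case (one i)
    show ?case by (rule eq)
  next
    case (diff a b)
    have "l (a - b) = l a \<otimes>\<^bsub>H\<^esub> inv\<^bsub>H\<^esub> l b"
      if "group_hom (free_Abelian_group UNIV) H l" for l
    proof -
      interpret l: group_hom "free_Abelian_group UNIV" H l by fact
      show ?thesis using l.hom_mult[of a "- b"] l.hom_inv[of b] by simp
    qed
    with diff show ?case using assms(1,2) by metis
  qed
qed

lemma affine_model_pow: "(0, 0, 1) [^]\<^bsub>affine_model\<^esub> n = (0, 0, n)" for n :: int
proof -
  have "(0, 0, 1) [^]\<^bsub>affine_model\<^esub> n = (0, 0, int n)" for n :: nat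
    by (induction n) auto
  then show ?thesis by (auto simp: int_pow_def2)
qed

lemma affine_model_pow': "(0, 1, 0) [^]\<^bsub>affine_model\<^esub> n = (0, n, 0)" for n :: int
proof -
  have "(0, 1, 0) [^]\<^bsub>affine_model\<^esub> n = (0, int n, 0)" for n :: nat
    by (induction n) auto
  then show ?thesis by (auto simp: int_pow_def2)
qed

text \<open>The locale is interpreted both by the HNN extension and by the group with three
  relators. The map \<open>\<phi>\<close> is a parameter because each of them obtains it from its
  own universal property.\<close>

locale br_generators = group Q for Q (structure) +
  fixes a s t and \<phi> :: "'a \<Rightarrow> ratfun \<times> int \<times> int"
  assumes a [simp]: "a \<in> carrier Q" and s [simp]: "s \<in> carrier Q" and t [simp]: "t \<in> carrier Q"
    and gen: "generate Q {a, s, t} = carrier Q"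
    and st: "s \<otimes> t = t \<otimes> s"
    and ta: "conjugate t a = a \<otimes> conjugate s a"
    and aa: "a \<otimes> conjugate s a = conjugate s a \<otimes> a"
    and \<phi>_hom: "\<phi> \<in> hom Q affine_model"
    and \<phi>_gens: "\<phi> a = (1, 0, 0)" "\<phi> s = (0, 1, 0)" "\<phi> t = (0, 0, 1)"
begin

sublocale \<phi>: group_hom Q affine_model \<phi>
  by (intro group_hom.intro group_hom_axioms.intro is_group group_affine_model \<phi>_hom)

definition ai :: "int \<Rightarrow> 'a" where "ai i = conjugate (s [^] i) a"

lemma ai_closed [simp]: "ai i \<in> carrier Q"
  by (simp add: ai_def)

lemma conjugate_s_ai: "conjugate (s [^] n) (ai i) = ai (i + n)" for n :: int
  by (simp add: ai_def conjugate_conjugate int_pow_mult[symmetric] add.commute)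

lemma ai_0: "ai 0 = a" and ai_1: "ai 1 = conjugate s a"
  by (simp_all add: ai_def int_pow_1)

lemma conjugate_t_s: "conjugate t (s [^] n) = s [^] n" for n :: int
proof -
  interpret c: group_hom Q Q "conjugate t"
    by unfold_locales (simp add: conjugate_hom)
  have "conjugate t s = s" using st by (simp add: conjugate_eq_iff)
  then show ?thesis using c.hom_int_pow[of s n] by simp
qed

lemma conjugate_t_ai: "conjugate t (ai i) = ai i \<otimes> ai (i + 1)"
proof -
  have "t \<otimes> s [^] i = s [^] i \<otimes> t"
    using conjugate_t_s[of i] by (simp add: conjugate_eq_iff)
  then have "conjugate t (ai i) = conjugate (s [^] i) (conjugate t a)"
    by (simp add: ai_def conjugate_conjugate)
  also have "\<dots> = conjugate (s [^] i) (ai 0 \<otimes> ai 1)"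
    by (simp only: ta ai_0 ai_1)
  also have "\<dots> = ai i \<otimes> ai (i + 1)"
    by (simp add: conjugate_mult_arg conjugate_s_ai add.commute)
  finally show ?thesis .
qed

text \<open>Strong induction on the gap \<open>n\<close>, for all \<open>i\<close> at once. Gap
  \<open>1\<close> is the relation \<open>aa\<close> conjugated by a power of \<open>s\<close>. For
  \<open>n \<ge> 2\<close>, the relation of gap \<open>n - 1\<close> is conjugated by
  \<open>t\<close>, and \<open>commute_step\<close> uses three further commutations, of gaps
  \<open>n - 2\<close>, \<open>n - 1\<close> and \<open>n - 1\<close>.\<close>

lemma ai_commute_nat: "ai i \<otimes> ai (i + int n) = ai (i + int n) \<otimes> ai i"
proof (induction n arbitrary: i rule: less_induct)
  case (less n)
  consider "n = 0" | "n = 1" | m where "n = Suc (Suc m)"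
    by (metis One_nat_def not0_implies_Suc)
  then show ?case
  proof cases
    case 2
    have "conjugate (s [^] i) (ai 0 \<otimes> ai 1) = conjugate (s [^] i) (ai 1 \<otimes> ai 0)"
      using aa by (simp add: ai_0 ai_1)
    then show ?thesis
      using 2 by (simp add: conjugate_mult_arg conjugate_s_ai add.commute)
  next
    case (3 m)
    have "conjugate t (ai i \<otimes> ai (i + int (Suc m))) = conjugate t (ai (i + int (Suc m)) \<otimes> ai i)"
      using less[of "Suc m" i] 3 by simp
    then have *: "ai i \<otimes> ai (i + 1) \<otimes> (ai (i + int (Suc m)) \<otimes> ai (i + int (Suc m) + 1)) =
      ai (i + int (Suc m)) \<otimes> ai (i + int (Suc m) + 1) \<otimes> (ai i \<otimes> ai (i + 1))"
      by (simp only: conjugate_mult_arg ai_closed t conjugate_t_ai)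
    have "ai i \<otimes> ai (i + int (Suc m) + 1) = ai (i + int (Suc m) + 1) \<otimes> ai i"
    proof (rule commute_step[OF _ _ _ _ *])
      show "ai (i + 1) \<otimes> ai (i + int (Suc m)) = ai (i + int (Suc m)) \<otimes> ai (i + 1)"
        using less[of m "i + 1"] 3 by (simp add: ac_simps)
      show "ai (i + 1) \<otimes> ai (i + int (Suc m) + 1) = ai (i + int (Suc m) + 1) \<otimes> ai (i + 1)"
        using less[of "Suc m" "i + 1"] 3 by (simp add: ac_simps)
      show "ai i \<otimes> ai (i + int (Suc m)) = ai (i + int (Suc m)) \<otimes> ai i"
        using less[of "Suc m" i] 3 by (simp add: ac_simps)
    qed simp_all
    then show ?thesis using 3 by (simp add: ac_simps)
  qed simp
qed

lemma ai_commute: "ai i \<otimes> ai j = ai j \<otimes> ai i"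
proof (cases "i \<le> j")
  case True
  then show ?thesis using ai_commute_nat[of i "nat (j - i)"] by simp
next
  case False
  then show ?thesis using ai_commute_nat[of j "nat (i - j)"] by simp
qed

definition \<alpha> :: "(int \<Rightarrow>\<^sub>0 int) \<Rightarrow> 'a" where
  "\<alpha> = (SOME h. group_hom (free_Abelian_group UNIV) Q h \<and> (\<forall>i. h (frag_of i) = ai i))"

text \<open>The universal property of the free abelian group needs a commutative target. It is
  therefore applied to the subgroup generated by the \<open>ai i\<close>, which is abelian by
  \<open>ai_commute\<close>, and the result is composed with the inclusion into
  \<open>Q\<close>.\<close>

lemma \<alpha>: "group_hom (free_Abelian_group UNIV) Q \<alpha> \<and> (\<forall>i. \<alpha> (frag_of i) = ai i)"
proof -
  let ?A = "Q\<lparr>carrier := generate Q (range ai)\<rparr>"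
  have range: "range ai \<subseteq> carrier Q" by auto
  interpret A: subgroup "generate Q (range ai)" Q
    by (rule generate_is_subgroup[OF range])
  interpret A: comm_group ?A
  proof (rule group.group_comm_groupI)
    show "group ?A" by (rule A.subgroup_is_group) (rule is_group)
    show "x \<otimes>\<^bsub>?A\<^esub> y = y \<otimes>\<^bsub>?A\<^esub> x" if "x \<in> carrier ?A" "y \<in> carrier ?A" for x y
      using that generate_commute[OF range, of x y] ai_commute by auto
  qed
  obtain h where h: "h \<in> hom (free_Abelian_group UNIV) ?A" "\<And>i. i \<in> UNIV \<Longrightarrow> h (frag_of i) = ai i"
    by (rule A.free_Abelian_group_universal[of ai UNIV]) (auto intro: generate.incl)
  have "h \<in> hom (free_Abelian_group UNIV) Q"
    using h(1) A.subset by (auto simp: hom_def)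
  then have "group_hom (free_Abelian_group UNIV) Q h"
    by (simp add: group_hom_def group_hom_axioms_def is_group)
  with h(2) have "\<exists>h. group_hom (free_Abelian_group UNIV) Q h \<and> (\<forall>i. h (frag_of i) = ai i)"
    by auto
  then show ?thesis unfolding \<alpha>_def by (rule someI_ex)
qed

sublocale \<alpha>: group_hom "free_Abelian_group UNIV" Q \<alpha>
  using \<alpha> by blast

lemma \<alpha>_frag_of: "\<alpha> (frag_of i) = ai i"
  using \<alpha> by blast

lemma \<alpha>_closed [simp]: "\<alpha> x \<in> carrier Q"
  using \<alpha>.hom_closed[of x] by simp

lemma \<alpha>_add: "\<alpha> (x + y) = \<alpha> x \<otimes> \<alpha> y"
  using \<alpha>.hom_mult[of x y] by simp

lemma group_hom_from_free:
  assumes "group H" "\<And>x. h x \<in> carrier H" "\<And>x y. h (x + y) = h x \<otimes>\<^bsub>H\<^esub> h y"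
  shows "group_hom (free_Abelian_group UNIV) H h"
  using assms by (auto simp: group_hom_def group_hom_axioms_def hom_def)

text \<open>Both sides are homomorphisms in \<open>x\<close> that agree on every
  \<open>frag_of i\<close>. The same comparison proves \<open>conjugate_t_\<alpha>\<close> and
  \<open>\<phi>_\<alpha>\<close>.\<close>

lemma conjugate_s_\<alpha>: "conjugate (s [^] n) (\<alpha> x) = \<alpha> (shift n x)" for n :: int
  by (rule free_Abelian_hom_eqI[where h = "\<lambda>x. conjugate (s [^] n) (\<alpha> x)" and H = Q])
    (auto intro!: group_hom_from_free is_group simp: \<alpha>_add conjugate_mult_arg shift_add \<alpha>_frag_of conjugate_s_ai)

lemma conjugate_t_\<alpha>: "conjugate t (\<alpha> x) = \<alpha> (x + shift 1 x)"
proof (rule free_Abelian_hom_eqI[where h = "\<lambda>x. conjugate t (\<alpha> x)" and H = Q])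
  show "group_hom (free_Abelian_group UNIV) Q (\<lambda>x. \<alpha> (x + shift 1 x))"
  proof (intro group_hom_from_free is_group)
    fix x y :: "int \<Rightarrow>\<^sub>0 int"
    have "x + y + shift 1 (x + y) = (x + shift 1 x) + (y + shift 1 y)"
      by (simp add: shift_add)
    then show "\<alpha> (x + y + shift 1 (x + y)) = \<alpha> (x + shift 1 x) \<otimes> \<alpha> (y + shift 1 y)"
      by (simp only: \<alpha>_add)
  qed simp
qed (auto intro!: group_hom_from_free is_group simp: \<alpha>_add conjugate_mult_arg \<alpha>_frag_of conjugate_t_ai)

lemma \<phi>_\<alpha>: "\<phi> (\<alpha> x) = (laurent_eval x, 0, 0)"
proof (rule free_Abelian_hom_eqI[where h = "\<lambda>x. \<phi> (\<alpha> x)" and H = affine_model])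
  show "\<phi> (\<alpha> (frag_of i)) = (laurent_eval (frag_of i), 0, 0)" for i
    using \<phi>.hom_int_pow[of s i]
    by (simp add: \<alpha>_frag_of ai_def conjugate_def \<phi>_gens affine_model_pow' unit_fract_def)
qed (auto intro!: group_hom_from_free group_affine_model simp: \<alpha>_add laurent_eval_add)

text \<open>This is the homomorphism from \<open>Z_wr_Z\<close> to \<open>Q\<close> with
  \<open>wr_a 0 \<mapsto> a\<close> and \<open>wr_s \<mapsto> s\<close>.\<close>

definition \<omega> :: "(int \<Rightarrow>\<^sub>0 int) \<times> int \<Rightarrow> 'a" where
  "\<omega> w = \<alpha> (fst w) \<otimes> s [^] snd w"

lemma \<omega>_closed [simp]: "\<omega> w \<in> carrier Q"
  by (simp add: \<omega>_def)

lemma \<omega>_mult: "\<omega> v \<otimes> \<omega> w = \<omega> (v \<otimes>\<^bsub>Z_wr_Z\<^esub> w)"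
proof -
  obtain f m g n where [simp]: "v = (f, m)" "w = (g, n)" by (cases v; cases w)
  have "\<omega> v \<otimes> \<omega> w = \<alpha> f \<otimes> (s [^] m \<otimes> \<alpha> g) \<otimes> s [^] n"
    by (simp add: \<omega>_def m_assoc)
  also have "s [^] m \<otimes> \<alpha> g = \<alpha> (shift m g) \<otimes> s [^] m"
    by (simp flip: conjugate_s_\<alpha> add: conjugate_mult_left)
  finally show ?thesis by (simp add: \<omega>_def \<alpha>_add m_assoc int_pow_mult)
qed

lemma conjugate_t_\<omega>: "conjugate t (\<omega> w) = \<omega> (br_endo w)"
  by (cases w) (simp add: \<omega>_def br_endo_eq conjugate_mult_arg conjugate_t_\<alpha> conjugate_t_s)

lemma \<phi>_\<omega>: "\<phi> (\<omega> w) = wr_model w"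
  using \<phi>.hom_int_pow[of s "snd w"]
  by (cases w) (simp add: \<omega>_def \<phi>_\<alpha> wr_model_def \<phi>_gens affine_model_pow')

text \<open>The exponent of \<open>t\<close> can be lowered at the price of applying
  \<open>br_endo\<close>. This brings two conjugates of base elements to a common exponent, where
  they can be multiplied inside the base.\<close>

lemma conjugate_t_pow_\<omega>: "conjugate (t [^] m) (\<omega> w) = conjugate (t [^] (m - int n)) (\<omega> ((br_endo ^^ n) w))" for m :: int
proof (induction n arbitrary: m w)
  case (Suc n)
  have "t [^] m = t [^] (m - 1) \<otimes> t"
    using int_pow_mult[of t "m - 1" 1] by (simp add: int_pow_1)
  then have "conjugate (t [^] m) (\<omega> w) = conjugate (t [^] (m - 1)) (\<omega> (br_endo w))"
    by (simp add: conjugate_t_\<omega> flip: conjugate_conjugate)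
  also have "\<dots> = conjugate (t [^] (m - int (Suc n))) (\<omega> ((br_endo ^^ Suc n) w))"
    using Suc[of "m - 1" "br_endo w"] by (simp add: funpow_swap1 algebra_simps)
  finally show ?case .
qed simp

text \<open>Generators and their inverses have this form with \<open>m = 0\<close>. In a product,
  moving \<open>t [^] l\<close> to the right past the second conjugate adds \<open>l\<close> to its
  exponent, after which both conjugates are lowered to the same exponent and merged by
  \<open>\<omega>_mult\<close>.\<close>

lemma normal_form:
  assumes "x \<in> carrier Q"
  shows "\<exists>(m::int) w (l::int). x = conjugate (t [^] m) (\<omega> w) \<otimes> t [^] l"
proof -
  have 1: "\<omega> (0, 0) = \<one>"
    using \<alpha>.hom_one by (simp add: \<omega>_def)
  have base: "\<exists>(m::int) w' (l::int). \<omega> w = conjugate (t [^] m) (\<omega> w') \<otimes> t [^] l" for w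
    by (intro exI[of _ "0::int"] exI[of _ w]) simp
  have pow: "\<exists>(m::int) w (l::int). t [^] n = conjugate (t [^] m) (\<omega> w) \<otimes> t [^] l" for n :: int
    by (intro exI[of _ "0::int"] exI[of _ "(0, 0)"] exI[of _ n]) (simp add: 1)
  have s\<omega>: "s [^] n = \<omega> (0, n)" for n :: int
    using \<alpha>.hom_one by (simp add: \<omega>_def)
  have a\<omega>: "a = \<omega> (frag_of 0, 0)"
    using \<alpha>_frag_of[of 0] ai_0 unfolding \<omega>_def fst_conv snd_conv by simp
  have "\<omega> (- frag_of 0, 0) \<otimes> \<omega> (frag_of 0, 0) = \<one>"
    unfolding \<omega>_mult by (simp add: 1)
  then have "\<omega> (- frag_of 0, 0) \<otimes> a = \<one>"
    unfolding a\<omega>[symmetric] .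
  then have inva: "inv a = \<omega> (- frag_of 0, 0)"
    by (intro inv_equality) simp_all
  have "x \<in> generate Q {a, s, t}" using assms gen by simp
  then show ?thesis
  proof (induction rule: generate.induct)
    case one
    show ?case using base[of "(0, 0)"] by (simp add: 1)
  next
    case (incl h)
    then show ?case using base[of "(frag_of 0, 0)"] base[of "(0, 1)"] pow[of 1]
      unfolding a\<omega>[symmetric] s\<omega>[symmetric] by (auto simp: int_pow_1)
  next
    case (inv h)
    then show ?case using base[of "(- frag_of 0, 0)"] base[of "(0, -1)"] pow[of "-1"]
      unfolding inva[symmetric] s\<omega>[symmetric] by (auto simp: int_pow_neg int_pow_1)
  next
    case (eng h1 h2)
    then obtain m w l m' w' l' :: int and v v' where
      h1: "h1 = conjugate (t [^] m) (\<omega> v) \<otimes> t [^] l" and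
      h2: "h2 = conjugate (t [^] m') (\<omega> v') \<otimes> t [^] l'" by blast
    \<comment> \<open>Exponents can only be lowered, so the common exponent is the minimum of the
      two.\<close>
    define M where "M = min m (l + m')"
    define u where "u = (br_endo ^^ nat (m - M)) v"
    define u' where "u' = (br_endo ^^ nat (l + m' - M)) v'"
    have u: "conjugate (t [^] m) (\<omega> v) = conjugate (t [^] M) (\<omega> u)"
      using conjugate_t_pow_\<omega>[of m v "nat (m - M)"] by (simp add: u_def M_def)
    have u': "conjugate (t [^] (l + m')) (\<omega> v') = conjugate (t [^] M) (\<omega> u')"
      using conjugate_t_pow_\<omega>[of "l + m'" v' "nat (l + m' - M)"] by (simp add: u'_def M_def)
    have "h1 \<otimes> h2 = conjugate (t [^] m) (\<omega> v) \<otimes> (t [^] l \<otimes> conjugate (t [^] m') (\<omega> v')) \<otimes> t [^] l'"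
      by (simp add: h1 h2 m_assoc)
    also have "t [^] l \<otimes> conjugate (t [^] m') (\<omega> v') = conjugate (t [^] (l + m')) (\<omega> v') \<otimes> t [^] l"
      by (simp add: int_pow_mult flip: conjugate_conjugate) (simp add: conjugate_mult_left)
    also have "conjugate (t [^] m) (\<omega> v) \<otimes> (conjugate (t [^] (l + m')) (\<omega> v') \<otimes> t [^] l) \<otimes> t [^] l' =
        conjugate (t [^] M) (\<omega> u) \<otimes> conjugate (t [^] M) (\<omega> u') \<otimes> (t [^] l \<otimes> t [^] l')"
      unfolding u u' by (simp add: m_assoc)
    also have "\<dots> = conjugate (t [^] M) (\<omega> (u \<otimes>\<^bsub>Z_wr_Z\<^esub> u')) \<otimes> t [^] (l + l')"
      by (simp add: conjugate_mult_arg int_pow_mult flip: \<omega>_mult)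
    finally show ?case by blast
  qed
qed

lemma \<phi>_inj: "inj_on \<phi> (carrier Q)"
  unfolding \<phi>.inj_on_one_iff
proof (intro allI impI)
  fix x assume x: "x \<in> carrier Q" and "\<phi> x = \<one>\<^bsub>affine_model\<^esub>"
  then have 1: "\<phi> x = (0, 0, 0)" by simp
  obtain m l :: int and w where x: "x = conjugate (t [^] m) (\<omega> w) \<otimes> t [^] l"
    using normal_form[OF x] by blast
  obtain f n where w: "w = (f, n)" by (cases w)
  have T: "\<phi> (t [^] i) = (0, 0, i)" for i :: int
    using \<phi>.hom_int_pow[of t i] by (simp add: \<phi>_gens affine_model_pow)
  \<comment> \<open>The coordinates of \<open>\<phi> x\<close> are
    \<open>(1 + fract_X) powi m * laurent_eval f\<close>, \<open>n\<close> and
    \<open>l\<close>.\<close>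
  have "n = 0 \<and> l = 0 \<and> laurent_eval f = 0"
    using 1 by (simp add: x w conjugate_def T \<phi>_\<omega> wr_model_def)
  then show "x = \<one>"
    using \<alpha>.hom_one by (simp add: x w laurent_eval_eq_0 \<omega>_def conjugate_def)
qed

end

section \<open>Separability and polycyclic subgroups\<close>

lemma (in group) not_LERF_if_strictly_ascending:
  assumes S: "finite S" "S \<subseteq> carrier G" and t: "t \<in> carrier G"
    and asc: "\<And>x. x \<in> generate G S \<Longrightarrow> conjugate t x \<in> generate G S"
    and w: "w \<in> generate G S" "conjugate (inv t) w \<notin> generate G S"
  shows "\<not> LERF G"
proof
  assume "LERF G"
  then obtain \<K> where fin: "\<And>K. K \<in> \<K> \<Longrightarrow> finite_index_subgroup K G" and eq: "generate G S = \<Inter>\<K>"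
    using S unfolding LERF_def by meson
  with w(2) obtain K where K: "K \<in> \<K>" "conjugate (inv t) w \<notin> K" by blast
  interpret K: subgroup K G using fin[OF K(1)] by (simp add: finite_index_subgroup_def)
  \<comment> \<open>Pigeonhole: two powers of \<open>t\<close> lie in the same coset of
    \<open>K\<close>, so a positive power of \<open>t\<close> lies in \<open>K\<close>.\<close>
  have "range (\<lambda>i::nat. K #> (t [^] i)) \<subseteq> rcosets K"
    using t by (auto simp: RCOSETS_def)
  then have "finite (range (\<lambda>i::nat. K #> (t [^] i)))"
    using fin[OF K(1)] finite_subset by (auto simp: finite_index_subgroup_def)
  then have "\<not> inj (\<lambda>i::nat. K #> (t [^] i))"
    using finite_imageD infinite_UNIV_nat by blast
  then obtain i j :: nat where ij: "i < j" "K #> (t [^] i) = K #> (t [^] j)"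
    by (metis injI linorder_neqE_nat)
  \<comment> \<open>The shift by one makes \<open>Suc n\<close> the positive exponent
    \<open>j - i\<close>.\<close>
  define n where "n = j - i - 1"
  have "t [^] j \<in> K #> (t [^] i)"
    unfolding ij(2) using t by (simp add: rcos_self K.subgroup_axioms)
  then obtain k where k: "k \<in> K" "t [^] j = k \<otimes> t [^] i"
    by (auto simp: r_coset_def)
  have "t [^] j = t [^] Suc n \<otimes> t [^] i"
    using ij(1) t unfolding nat_pow_mult[OF t] by (simp add: n_def)
  then have tK: "t [^] Suc n \<in> K"
    using k t K.mem_carrier[OF k(1)] by (metis nat_pow_closed right_cancel)
  have gen: "generate G S \<subseteq> carrier G" by (rule generate_incl[OF S(2)])
  have "conjugate (t [^] m) w \<in> generate G S" for m :: nat
  proof (induction m)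
    case (Suc m)
    have "conjugate (t [^] Suc m) w = conjugate t (conjugate (t [^] m) w)"
      unfolding nat_pow_Suc2[OF t] using t w gen by (intro conjugate_conjugate[symmetric]) auto
    with asc[OF Suc] show ?case by simp
  qed (use w gen in auto)
  then have "conjugate (t [^] n) w \<in> K" using K(1) eq by auto
  \<comment> \<open>Going up by \<open>t [^] n\<close> stays in \<open>generate G S\<close>, hence
    in \<open>K\<close>; going down by \<open>t [^] Suc n\<close> stays in \<open>K\<close>. The net
    effect is conjugation by \<open>inv t\<close>.\<close>
  then have "inv (t [^] Suc n) \<otimes> conjugate (t [^] n) w \<otimes> t [^] Suc n \<in> K"
    using tK by blast
  also have "inv (t [^] Suc n) \<otimes> conjugate (t [^] n) w \<otimes> t [^] Suc n =
      conjugate (inv (t [^] Suc n)) (conjugate (t [^] n) w)"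
    using t by (simp add: conjugate_def)
  also have "\<dots> = conjugate (inv (t [^] Suc n) \<otimes> t [^] n) w"
    using t w gen by (subst conjugate_conjugate) auto
  also have "inv (t [^] Suc n) \<otimes> t [^] n = inv t"
    using t by (simp add: inv_mult_group m_assoc)
  finally show False using K(2) by contradiction
qed

section \<open>Subgroups of polycyclic groups\<close>

lemma int_subgroup_generator:
  fixes I :: "int set"
  assumes "0 \<in> I" and diff: "\<And>m n. m \<in> I \<Longrightarrow> n \<in> I \<Longrightarrow> m - n \<in> I"
  obtains d where "d \<in> I" "\<And>n. n \<in> I \<Longrightarrow> d dvd n"
proof (cases "\<exists>d\<in>I. d > 0")
  case True
  \<comment> \<open>The generator is the least positive element of \<open>I\<close>; if there is
    none, then \<open>I\<close> contains only \<open>0\<close>.\<close>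
  define d where "d = (LEAST n. int n \<in> I \<and> n > 0)"
  from True obtain e where "e \<in> I" "e > 0" by blast
  then have "\<exists>n. int n \<in> I \<and> n > 0" by (intro exI[of _ "nat e"]) auto
  then have d: "int d \<in> I" "d > 0" unfolding d_def by (metis (mono_tags, lifting) LeastI_ex)+
  have "int d dvd n" if "n \<in> I" for n
  proof (rule ccontr)
    assume nd: "\<not> int d dvd n"
    have neg: "- m \<in> I" if "m \<in> I" for m using diff[OF assms(1) that] by simp
    have pos: "int k * int d \<in> I" for k
    proof (induction k)
      case (Suc k)
      then show ?case using diff[OF Suc neg[OF d(1)]] by (simp add: algebra_simps)
    qed (use assms in simp)
    have "k * int d \<in> I" for k
      using pos[of "nat k"] neg[OF pos[of "nat (- k)"]] by (cases "k \<ge> 0") auto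
    \<comment> \<open>The remainder of \<open>n\<close> modulo \<open>d\<close> lies in
      \<open>I\<close> and is smaller than \<open>d\<close>, so a nonzero remainder contradicts
      minimality.\<close>
    from diff[OF that this[of "n div int d"]] have "n mod int d \<in> I"
      by (simp add: minus_div_mult_eq_mod)
    have "n mod int d \<noteq> 0" using nd by (simp only: dvd_eq_mod_eq_0 not_False_eq_True)
    moreover have "n mod int d \<ge> 0" "n mod int d < int d"
      using d(2) by simp_all
    ultimately have "n mod int d > 0" "n mod int d < int d" by linarith+
    with \<open>n mod int d \<in> I\<close> have "int (nat (n mod int d)) \<in> I \<and> nat (n mod int d) > 0"
      by simp
    then have "d \<le> nat (n mod int d)" unfolding d_def by (rule Least_le)
    with \<open>n mod int d < int d\<close> \<open>n mod int d > 0\<close> show False by linarith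
  qed
  with d that show thesis by blast
next
  case False
  have "n = 0" if "n \<in> I" for n
    using False that diff[OF assms(1) that] by (metis diff_0 linorder_neqE_linordered_idom neg_0_less_iff_less)
  with assms that show thesis by auto
qed

text \<open>Induction along the series: \<open>C \<inter> K\<close> is finitely generated by
  hypothesis, and the image of \<open>C\<close> in the cyclic quotient of \<open>H\<close> by
  \<open>K\<close> is cyclic, so one more generator suffices.\<close>

lemma (in group) polycyclic_subgroup_finitely_generated:
  assumes "polycyclic_seq G H" "subgroup C G" "C \<subseteq> H"
  shows "\<exists>S. finite S \<and> S \<subseteq> C \<and> generate G S = C"
  using assms
proof (induction arbitrary: C)
  case unity
  then have "C = {\<one>}" using subgroup.one_closed by fastforce
  then show ?case by (intro exI[of _ "{}"]) (auto simp: generate_empty)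
next
  case (extension K H)
  let ?H = "G\<lparr>carrier := H\<rparr>"
  interpret C: subgroup C G by fact
  interpret H: subgroup H G by fact
  interpret GH: group ?H by (rule H.subgroup_is_group) (rule is_group)
  interpret K: normal K ?H by fact
  interpret M: group "?H Mod K" by (rule K.factorgroup_is_group)
  interpret q: group_hom ?H "?H Mod K" "\<lambda>x. K #>\<^bsub>?H\<^esub> x"
    by (intro group_hom.intro group_hom_axioms.intro K.factorgroup_is_group K.r_coset_hom_Mod GH.is_group)
  have KG: "subgroup K G"
    by (rule incl_subgroup[OF H.subgroup_axioms K.subgroup_axioms])
  obtain X where X: "X \<in> carrier (?H Mod K)" "carrier (?H Mod K) = range (\<lambda>n::int. X [^]\<^bsub>?H Mod K\<^esub> n)"
    using extension.hyps M.cyclic_group by auto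
  have CH: "subgroup C ?H"
    by (rule subgroup_incl[OF C.subgroup_axioms H.subgroup_axioms \<open>C \<subseteq> H\<close>])
  have sub: "subgroup ((\<lambda>x. K #>\<^bsub>?H\<^esub> x) ` C) (?H Mod K)"
    by (rule q.subgroup_img_is_subgroup[OF CH])
  \<comment> \<open>\<open>I\<close> collects the exponents of \<open>X\<close> that occur in the
    image of \<open>C\<close>. It is generated by some \<open>d\<close>, and \<open>c\<close> is a
    lift to \<open>C\<close> of the \<open>d\<close>-th power of \<open>X\<close>.\<close>
  define I where "I = {n::int. X [^]\<^bsub>?H Mod K\<^esub> n \<in> (\<lambda>x. K #>\<^bsub>?H\<^esub> x) ` C}"
  have "0 \<in> I" using subgroup.one_closed[OF sub] by (simp add: I_def)
  moreover have "m - n \<in> I" if "m \<in> I" "n \<in> I" for m n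
    using that subgroup.m_closed[OF sub _ subgroup.m_inv_closed[OF sub]] X(1)
    unfolding I_def mem_Collect_eq M.int_pow_diff[OF X(1)] by blast
  ultimately obtain d where d: "d \<in> I" "\<And>n. n \<in> I \<Longrightarrow> d dvd n"
    using int_subgroup_generator by blast
  then obtain c where c: "c \<in> C" "X [^]\<^bsub>?H Mod K\<^esub> d = K #>\<^bsub>?H\<^esub> c"
    by (auto simp: I_def)
  have "subgroup (C \<inter> K) G" by (rule subgroups_Inter_pair[OF C.subgroup_axioms KG])
  then obtain S where S: "finite S" "S \<subseteq> C \<inter> K" "generate G S = C \<inter> K"
    using extension.IH[of "C \<inter> K"] by auto
  have cS: "insert c S \<subseteq> C" using c S by auto
  interpret g: subgroup "generate G (insert c S)" G
    using cS C.subset by (intro generate_is_subgroup) auto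
  have "x \<in> generate G (insert c S)" if x: "x \<in> C" for x
  proof -
    have xH: "x \<in> carrier ?H" "c \<in> carrier ?H" using x c extension.prems by auto
    have "K #>\<^bsub>?H\<^esub> x \<in> carrier (?H Mod K)" using q.hom_closed[OF xH(1)] .
    then obtain n :: int where n: "K #>\<^bsub>?H\<^esub> x = X [^]\<^bsub>?H Mod K\<^esub> n" using X(2) by auto
    with x have "n \<in> I" unfolding I_def by (metis imageI mem_Collect_eq)
    with d obtain e where e: "n = d * e" by (metis dvdE)
    \<comment> \<open>Dividing \<open>x\<close> by the power of \<open>c\<close> with the same image
      leaves an element of \<open>C \<inter> K\<close>, which \<open>S\<close> generates.\<close>
    define y where "y = x \<otimes>\<^bsub>?H\<^esub> inv\<^bsub>?H\<^esub> (c [^]\<^bsub>?H\<^esub> e)"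
    have y: "y \<in> carrier ?H" unfolding y_def using xH by (intro GH.m_closed GH.inv_closed GH.int_pow_closed)
    have ce: "c [^]\<^bsub>?H\<^esub> e \<in> carrier ?H" by (rule GH.int_pow_closed[OF xH(2)])
    have eq: "K #>\<^bsub>?H\<^esub> x = K #>\<^bsub>?H\<^esub> (c [^]\<^bsub>?H\<^esub> e)"
      unfolding q.hom_int_pow[OF xH(2)] c(2)[symmetric] M.int_pow_pow[OF X(1)] n e ..
    have "K #>\<^bsub>?H\<^esub> y = (K #>\<^bsub>?H\<^esub> x) \<otimes>\<^bsub>?H Mod K\<^esub> inv\<^bsub>?H Mod K\<^esub> (K #>\<^bsub>?H\<^esub> (c [^]\<^bsub>?H\<^esub> e))"
      unfolding y_def q.hom_inv[OF ce, symmetric] by (intro q.hom_mult GH.inv_closed xH ce)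
    also have "\<dots> = \<one>\<^bsub>?H Mod K\<^esub>"
      unfolding eq by (intro M.r_inv q.hom_closed ce)
    finally have "K #>\<^bsub>?H\<^esub> y = \<one>\<^bsub>?H Mod K\<^esub>" .
    then have "y \<in> K" using GH.rcos_self[OF y K.subgroup_axioms] by simp
    moreover have ce': "c [^] e \<in> C" "c [^]\<^bsub>?H\<^esub> e = c [^] e"
      using c extension.prems subgroup_int_pow_closed[OF C.subgroup_axioms, of c e]
        int_pow_consistent[OF H.subgroup_axioms, of c e] by auto
    have "y = x \<otimes> inv (c [^] e)"
      using ce' extension.prems by (simp add: y_def m_inv_consistent[OF H.subgroup_axioms] subset_iff)
    moreover from this have "y \<in> C" using x ce' by simp
    ultimately have "x \<otimes> inv (c [^] e) \<in> generate G S" using S(3) by auto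
    then have "x \<otimes> inv (c [^] e) \<in> generate G (insert c S)"
      using mono_generate[of S "insert c S"] by auto
    moreover have "c [^] e \<in> generate G (insert c S)"
      by (intro subgroup_int_pow_closed[OF g.subgroup_axioms] generate.incl) auto
    ultimately have "x \<otimes> inv (c [^] e) \<otimes> c [^] e \<in> generate G (insert c S)" by (rule g.m_closed)
    then show ?thesis using x ce' by (simp add: m_assoc)
  qed
  moreover have "generate G (insert c S) \<subseteq> C"
    by (rule generate_subgroup_incl[OF cS C.subgroup_axioms])
  ultimately show ?case using S(1) cS by (intro exI[of _ "insert c S"]) auto
qed

section \<open>Bounded fractions and multiplication by units\<close>

definition bounded_fractions :: "int poly \<Rightarrow> nat \<Rightarrow> ratfun set" where
  "bounded_fractions D d = {z. \<exists>p. to_fract D * z = to_fract p \<and> degree p \<le> d}"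

lemma bounded_fractions_0: "0 \<in> bounded_fractions D d"
  unfolding bounded_fractions_def by (auto intro!: exI[of _ 0])

lemma bounded_fractions_diff:
  assumes "y \<in> bounded_fractions D d" "z \<in> bounded_fractions D d"
  shows "y - z \<in> bounded_fractions D d"
proof -
  obtain p q where "to_fract D * y = to_fract p" "to_fract D * z = to_fract q" "degree p \<le> d" "degree q \<le> d"
    using assms by (auto simp: bounded_fractions_def)
  then show ?thesis
    unfolding bounded_fractions_def
    by (auto intro!: exI[of _ "p - q"] degree_diff_le simp: right_diff_distrib)
qed

text \<open>For \<open>D = 0\<close> every fraction would belong to
  \<open>bounded_fractions D d\<close>, hence the demand \<open>D \<noteq> 0\<close>. A new fraction
  \<open>p / q\<close> is absorbed by passing to the common denominator
  \<open>D * q\<close>.\<close>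

lemma finite_bounded_fractions:
  assumes "finite Z"
  shows "\<exists>D d. D \<noteq> 0 \<and> Z \<subseteq> bounded_fractions D d"
  using assms
proof (induction rule: finite_induct)
  case empty
  show ?case by (auto intro: exI[of _ 1])
next
  case (insert z Z)
  then obtain D d where D: "D \<noteq> 0" "Z \<subseteq> bounded_fractions D d" by blast
  obtain p q where z: "z = Fract p q" "q \<noteq> 0" by (cases z) auto
  \<comment> \<open>The first bound covers the old numerators, now multiplied by \<open>q\<close>;
    the second covers the numerator \<open>D * p\<close> of the new fraction.\<close>
  define e where "e = max (degree q + d) (degree (D * p))"
  have "y \<in> bounded_fractions (D * q) e" if "y \<in> Z" for y
  proof -
    obtain r where r: "to_fract D * y = to_fract r" "degree r \<le> d"
      using subsetD[OF D(2) \<open>y \<in> Z\<close>] by (auto simp: bounded_fractions_def)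
    have "to_fract (D * q) * y = to_fract (q * r)" using r(1) by (simp add: mult_ac)
    moreover have "degree (q * r) \<le> e"
      using degree_mult_le[of q r] r(2) by (simp add: e_def)
    ultimately show ?thesis unfolding bounded_fractions_def by blast
  qed
  moreover have "to_fract (D * q) * z = to_fract (D * p)"
    using z by (simp add: Fract_conv_to_fract)
  then have "z \<in> bounded_fractions (D * q) e"
    unfolding bounded_fractions_def e_def by (intro CollectI exI[of _ "D * p"]) auto
  ultimately show ?case
    using D z by (intro exI[of _ "D * q"] exI[of _ e]) auto
qed

text \<open>Clearing negative exponents gives an identity of polynomials in which only powers of
  \<open>X\<close> and \<open>1 + X\<close> are added to \<open>p\<close> and \<open>q\<close>.
  These factors have their only roots at \<open>0\<close> and \<open>- 1\<close>, and both are of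
  degree one.\<close>

lemma unit_fract_orders:
  assumes eq: "unit_fract i j * to_fract q = to_fract p" and "q \<noteq> 0"
  shows "int (order 0 p) = i + int (order 0 q)" "int (order (- 1) p) = j + int (order (- 1) q)"
    "int (degree p) = i + j + int (degree q)"
proof -
  have pows: "unit_fract (int m) (int n) = to_fract ([:0, 1:] ^ m * [:1, 1:] ^ n)" for m n
  proof -
    have "to_fract r ^ n = to_fract (r ^ n)" for r :: "int poly" and n
      by (induction n) auto
    moreover have "1 + fract_X = to_fract [:1, 1:]"
      unfolding fract_X_def to_fract_1[symmetric] to_fract_add[symmetric] by (simp add: one_pCons)
    ultimately show ?thesis by (simp add: unit_fract_def fract_X_def power_int_def)
  qed
  \<comment> \<open>Positive and negative parts: \<open>i = i1 - i2\<close> and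
    \<open>j = j1 - j2\<close> in the integers.\<close>
  define i1 i2 j1 j2 where ij: "i1 = nat i" "i2 = nat (- i)" "j1 = nat j" "j2 = nat (- j)"
  have "unit_fract (int i1) (int j1) = unit_fract (int i2) (int j2) * unit_fract i j"
    unfolding unit_fract_add[symmetric] by (intro arg_cong2[where f = unit_fract]) (auto simp: ij)
  then have "to_fract ([:0, 1:] ^ i2 * [:1, 1:] ^ j2 * p) = to_fract ([:0, 1:] ^ i1 * [:1, 1:] ^ j1 * q)"
    by (simp only: to_fract_mult eq[symmetric] pows mult.assoc) (simp add: pows mult_ac)
  then have *: "[:0, 1:] ^ i2 * [:1, 1:] ^ j2 * p = [:0, 1:] ^ i1 * [:1, 1:] ^ j1 * q"
    by (simp only: to_fract_eq_iff)
  have p: "p \<noteq> 0" using assms by auto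
  have o: "order 0 ([:0, 1:] ^ m * [:1, 1:] ^ n * r) = m + order 0 r"
    "order (- 1) ([:0, 1:] ^ m * [:1, 1:] ^ n * r) = n + order (- 1) r"
    "degree ([:0, 1:] ^ m * [:1, 1:] ^ n * r) = m + n + degree r"
    if "r \<noteq> 0" for m n and r :: "int poly"
  proof -
    have "order 0 ([:0, 1:] ^ m :: int poly) = m" "order (- 1) ([:1, 1:] ^ n :: int poly) = n"
      using order_power_n_n[of "0::int" m] order_power_n_n[of "-1::int" n] by simp_all
    moreover have "order 0 ([:1, 1:] ^ n :: int poly) = 0" "order (- 1) ([:0, 1:] ^ m :: int poly) = 0"
      by (auto intro!: order_0I)
    ultimately show "order 0 ([:0, 1:] ^ m * [:1, 1:] ^ n * r) = m + order 0 r"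
      "order (- 1) ([:0, 1:] ^ m * [:1, 1:] ^ n * r) = n + order (- 1) r"
      using that by (simp_all add: order_mult)
    show "degree ([:0, 1:] ^ m * [:1, 1:] ^ n * r) = m + n + degree r"
      using that by (simp add: degree_mult_eq degree_power_eq)
  qed
  have "i2 + order 0 p = i1 + order 0 q" "j2 + order (- 1) p = j1 + order (- 1) q"
    "i2 + j2 + degree p = i1 + j1 + degree q"
    using arg_cong[OF *, of "order 0"] arg_cong[OF *, of "order (- 1)"] arg_cong[OF *, of degree]
      o[OF p] o[OF assms(2)] by simp_all
  then show "int (order 0 p) = i + int (order 0 q)" "int (order (- 1) p) = j + int (order (- 1) q)"
    "int (degree p) = i + j + int (degree q)"
    by (auto simp: ij)
qed

lemma int_bounded_multiples_nonneg:
  fixes i c :: int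
  assumes "\<And>k::nat. 0 \<le> int k * i + c"
  shows "0 \<le> i"
proof (rule ccontr)
  assume "\<not> 0 \<le> i"
  \<comment> \<open>The case \<open>k = 0\<close> gives \<open>c \<ge> 0\<close>; then
    \<open>k = c + 1\<close> and \<open>i \<le> - 1\<close> would make the value at most
    \<open>- 1\<close>.\<close>
  then have "int (nat (c + 1)) * i \<le> int (nat (c + 1)) * (- 1)"
    by (intro mult_left_mono) auto
  with assms[of "nat (c + 1)"] assms[of 0] show False by simp
qed

text \<open>The orders at \<open>0\<close> and \<open>- 1\<close> and the degree of the numerators
  of the fractions in \<open>b\<close> are linear in \<open>k\<close> with slopes \<open>i\<close>,
  \<open>j\<close> and \<open>i + j\<close>. Orders are nonnegative and degrees are at most
  \<open>d\<close>, which fixes the signs of the slopes.\<close>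

lemma unit_fract_bounded_imp_trivial:
  assumes "D \<noteq> 0" "z \<noteq> 0" and b: "\<And>k. unit_fract i j ^ k * z \<in> bounded_fractions D d"
  shows "i = 0 \<and> j = 0"
proof -
  have pow: "unit_fract i j ^ k = unit_fract (int k * i) (int k * j)" for k
    by (induction k) (auto simp: algebra_simps unit_fract_add)
  obtain q where q: "to_fract D * z = to_fract q"
    using b[of 0] by (auto simp: bounded_fractions_def)
  have "q \<noteq> 0" using q assms by (metis mult_eq_0_iff to_fract_eq_0_iff)
  have "0 \<le> int k * i + int (order 0 q) \<and> 0 \<le> int k * j + int (order (- 1) q) \<and>
      0 \<le> int k * - (i + j) + (int d - int (degree q))" for k
  proof -
    obtain p where p: "to_fract D * (unit_fract i j ^ k * z) = to_fract p" "degree p \<le> d"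
      using b[of k] by (auto simp: bounded_fractions_def)
    have "unit_fract (int k * i) (int k * j) * to_fract q = to_fract p"
      by (simp add: q[symmetric] p(1)[symmetric] pow mult_ac)
    from unit_fract_orders[OF this \<open>q \<noteq> 0\<close>] p(2) show ?thesis by (simp add: algebra_simps)
  qed
  then have "0 \<le> i" "0 \<le> j" "0 \<le> - (i + j)"
    using int_bounded_multiples_nonneg by metis+
  then show ?thesis by simp
qed

text \<open>Commutators have trivial image in the abelian group of pairs \<open>(i, j)\<close>, so
  they are translations, and translations commute.\<close>

lemma solvable_affine_model: "solvable affine_model"
proof -
  interpret group affine_model by (rule group_affine_model)
  let ?A = "range (\<lambda>m. (m, 0, 0)) :: (ratfun \<times> int \<times> int) set"
  have A: "subgroup ?A affine_model"
    by (rule subgroupI) auto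
  have "derived affine_model UNIV \<subseteq> ?A"
    unfolding derived_def by (rule generate_subgroup_incl[OF _ A]) auto
  moreover have "derived affine_model ?A \<subseteq> {\<one>\<^bsub>affine_model\<^esub>}"
    unfolding derived_def by (rule generate_subgroup_incl[OF _ triv_subgroup]) auto
  ultimately have "(derived affine_model ^^ 2) UNIV \<subseteq> {\<one>\<^bsub>affine_model\<^esub>}"
    using mono_derived[of "derived affine_model UNIV" ?A] by (simp add: numeral_2_eq_2)
  moreover have "\<one>\<^bsub>affine_model\<^esub> \<in> (derived affine_model ^^ 2) UNIV"
    using subgroup.one_closed[OF exp_of_derived_is_subgroup[OF subgroup_self, of 2]] by simp
  ultimately have "(derived affine_model ^^ 2) (carrier affine_model) = {\<one>\<^bsub>affine_model\<^esub>}"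
    unfolding carrier_affine_model by blast
  then show ?thesis using solvable_iff_trivial_derived_seq by blast
qed

section \<open>Consequences for groups with generators \<open>a\<close>, \<open>s\<close>,
  \<open>t\<close>\<close>

context br_generators
begin

lemma solvable: "solvable Q"
  by (rule \<phi>.inj_hom_imp_solvable[OF \<phi>_inj solvable_affine_model])

text \<open>The right-hand side does not mention \<open>Q\<close>, so any two groups satisfying the
  locale are isomorphic.\<close>

lemma iso_model:
  "Q \<cong> subgroup_generated affine_model (generate affine_model {(1, 0, 0), (0, 1, 0), (0, 0, 1)})"
proof -
  have "\<phi> ` carrier Q = generate affine_model {(1, 0, 0), (0, 1, 0), (0, 0, 1)}"
    using \<phi>.generate_img[of "{a, s, t}"] by (simp add: gen \<phi>_gens)
  then show ?thesis
    using Generated_Groups.iso_onto_image[OF is_group group_affine_model, of \<phi>] \<phi>_hom \<phi>_inj by (auto simp: is_iso_def)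
qed

lemma no_ascending_polycyclic:
  assumes B: "subgroup B Q" "polycyclic (Q\<lparr>carrier := B\<rparr>)" and h: "h \<in> carrier Q"
    and asc: "conjugate h ` B \<subset> B"
  shows False
proof -
  interpret B: subgroup B Q by fact
  let ?B = "Q\<lparr>carrier := B\<rparr>"
  interpret GB: group ?B by (rule B.subgroup_is_group) (rule is_group)
  \<comment> \<open>\<open>N\<close> is the kernel of the map from \<open>B\<close> to the pairs
    \<open>(i, j)\<close>, that is, the elements of \<open>B\<close> that become
    translations.\<close>
  define N where "N = {b \<in> B. snd (\<phi> b) = (0, 0)}"
  \<comment> \<open>Preimages in \<open>B\<close> of additive subgroups \<open>V\<close> of
    translations: \<open>V = UNIV\<close> yields \<open>N\<close>, and
    \<open>bounded_fractions D d\<close> yields a subgroup that contains the generators of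
    \<open>N\<close>.\<close>
  have *: "subgroup {b \<in> B. \<phi> b \<in> V \<times> {(0, 0)}} Q"
    if V: "0 \<in> V" "\<And>x y. x \<in> V \<Longrightarrow> y \<in> V \<Longrightarrow> x - y \<in> V" for V
  proof -
    have neg: "- x \<in> V" if "x \<in> V" for x using V that by (metis diff_0)
    have add: "x + y \<in> V" if "x \<in> V" "y \<in> V" for x y
      using V(2)[OF that(1) neg[OF that(2)]] by simp
    show ?thesis
    proof (rule subgroupI)
      have "\<phi> \<one> = (0, 0, 0)"
        using \<phi>.hom_one unfolding one_affine_model .
      then have "\<one> \<in> {b \<in> B. \<phi> b \<in> V \<times> {(0, 0)}}"
        using V(1) B.one_closed by simp
      then show "{b \<in> B. \<phi> b \<in> V \<times> {(0, 0)}} \<noteq> {}"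
        by (rule_tac notI) (simp only: empty_iff)
    next
      fix b assume b: "b \<in> {b \<in> B. \<phi> b \<in> V \<times> {(0, 0)}}"
      then obtain v where "\<phi> b = (v, 0, 0)" "v \<in> V" by auto
      with b show "inv b \<in> {b \<in> B. \<phi> b \<in> V \<times> {(0, 0)}}"
        by (simp add: neg)
    next
      fix b c
      assume b: "b \<in> {b \<in> B. \<phi> b \<in> V \<times> {(0, 0)}}" and c: "c \<in> {b \<in> B. \<phi> b \<in> V \<times> {(0, 0)}}"
      then obtain v w where "\<phi> b = (v, 0, 0)" "v \<in> V" "\<phi> c = (w, 0, 0)" "w \<in> V" by auto
      with b c show "b \<otimes> c \<in> {b \<in> B. \<phi> b \<in> V \<times> {(0, 0)}}"
        by (simp add: add)
    qed auto
  qed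
  have N: "subgroup N ?B"
    using subgroup_incl[OF *[of UNIV] B(1)] by (auto simp: N_def vimage_def mem_Times_iff cong: conj_cong)
  have "\<exists>S. finite S \<and> S \<subseteq> N \<and> generate ?B S = N"
    by (rule GB.polycyclic_subgroup_finitely_generated[OF _ N])
      (use B(2) in \<open>auto simp: polycyclic_def N_def\<close>)
  then obtain S where S: "finite S" "S \<subseteq> N" "generate ?B S = N" by blast
  obtain D d where D: "D \<noteq> 0" "(\<lambda>b. fst (\<phi> b)) ` S \<subseteq> bounded_fractions D d"
    using finite_bounded_fractions[of "(\<lambda>b. fst (\<phi> b)) ` S"] S(1) by auto
  let ?V = "{b \<in> B. \<phi> b \<in> bounded_fractions D d \<times> {(0, 0)}}"
  have "N \<subseteq> ?V"
    unfolding S(3)[symmetric]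
  proof (rule GB.generate_subgroup_incl)
    show "S \<subseteq> ?V" using S(2) D(2) by (auto simp: N_def mem_Times_iff)
    show "subgroup ?V ?B"
      by (intro subgroup_incl B(1) * bounded_fractions_0 bounded_fractions_diff) auto
  qed
  then have bound: "fst (\<phi> b) \<in> bounded_fractions D d" if "b \<in> N" for b
    using that by auto
  obtain m i j where \<phi>h: "\<phi> h = (m, i, j)" by (cases "\<phi> h")
  have conj_N: "conjugate h b \<in> N \<and> \<phi> (conjugate h b) = (unit_fract i j * fst (\<phi> b), 0, 0)" if bN: "b \<in> N" for b
  proof -
    have "b \<in> B" "conjugate h b \<in> B" using bN asc by (auto simp: N_def)
    moreover obtain z where "\<phi> b = (z, 0, 0)" using bN by (cases "\<phi> b") (auto simp: N_def)
    ultimately show ?thesis using h unit_fract_minus[of i j]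
      by (auto simp: N_def conjugate_def \<phi>h algebra_simps)
  qed
  obtain b where b: "b \<in> B" "b \<notin> conjugate h ` B" using asc by blast
  \<comment> \<open>Conjugate elements have the same pair \<open>(i, j)\<close>, so the quotient
    \<open>c\<close> lies in \<open>N\<close>. It inherits from \<open>b\<close> that it is not in
    the image of \<open>B\<close>, since \<open>b\<close> is \<open>c\<close> times a
    conjugate.\<close>
  define c where "c = b \<otimes> inv (conjugate h b)"
  have hb: "conjugate h b \<in> B" using asc b by blast
  have c: "c \<in> N"
  proof -
    obtain z k l where "\<phi> b = (z, k, l)" by (cases "\<phi> b")
    then show ?thesis
      using b hb h by (simp add: N_def c_def) (simp add: conjugate_def \<phi>h)
  qed
  have c_notin: "c \<notin> conjugate h ` B"
  proof
    assume "c \<in> conjugate h ` B"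
    then obtain e where e: "e \<in> B" "c = conjugate h e" by blast
    have "b = c \<otimes> conjugate h b" using b hb by (simp add: c_def m_assoc)
    also have "\<dots> = conjugate h (e \<otimes> b)" using e b h by (simp add: conjugate_mult_arg)
    finally show False using b e by blast
  qed
  \<comment> \<open>Iterated conjugation by \<open>h\<close> keeps \<open>c\<close> inside
    \<open>N\<close> while multiplying its translation part by \<open>unit_fract i j\<close> each
    time.\<close>
  have "(conjugate h ^^ k) c \<in> N \<and> fst (\<phi> ((conjugate h ^^ k) c)) = unit_fract i j ^ k * fst (\<phi> c)" for k
  proof (induction k)
    case (Suc k)
    then show ?case using conj_N[of "(conjugate h ^^ k) c"] by simp
  qed (use c in simp)
  then have b': "unit_fract i j ^ k * fst (\<phi> c) \<in> bounded_fractions D d" for k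
    using bound by metis
  have cB: "c \<in> B" "snd (\<phi> c) = (0, 0)" using c by (auto simp: N_def)
  have "fst (\<phi> c) \<noteq> 0"
  proof
    assume "fst (\<phi> c) = 0"
    then have "\<phi> c = \<phi> \<one>" using cB by (simp add: prod_eq_iff)
    then have "c = \<one>" using inj_onD[OF \<phi>_inj, of c \<one>] cB by auto
    moreover have "conjugate h \<one> = \<one>" using h by (simp add: conjugate_def)
    ultimately show False using c_notin B.one_closed by (metis imageI)
  qed
  with unit_fract_bounded_imp_trivial[OF D(1) _ b'] have "i = 0 \<and> j = 0" by blast
  \<comment> \<open>The multiplier is now \<open>1\<close>, so \<open>h\<close> fixes
    \<open>c\<close>, and \<open>c\<close> is in the image of \<open>B\<close> after all.\<close>
  then have "\<phi> (conjugate h c) = \<phi> c"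
    using conj_N[OF c] cB by (simp add: prod_eq_iff)
  then have "conjugate h c = c" using inj_onD[OF \<phi>_inj, of "conjugate h c" c] cB h by auto
  then show False using c_notin cB by (metis imageI)
qed

lemma not_contains_ascending_hnn_of_polycyclic:
  "\<not> contains_strictly_ascending_hnn_of_polycyclic Q"
proof
  assume "contains_strictly_ascending_hnn_of_polycyclic Q"
  then obtain H B h where H: "subgroup H Q" "subgroup B Q" "h \<in> H"
    "(\<lambda>b. h \<otimes> b \<otimes> inv h) ` B \<subset> B" "polycyclic (Q\<lparr>carrier := B\<rparr>)"
    unfolding contains_strictly_ascending_hnn_of_polycyclic_def is_strictly_ascending_hnn_def
    by (elim exE conjE) (rule that)
  have "h \<in> carrier Q" using subgroup.mem_carrier[OF H(1,3)] .
  then show False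
    using no_ascending_polycyclic[OF H(2,5)] H(4) by (simp add: conjugate_def[abs_def])
qed

end

section \<open>The Baumslag-Remeslennikov group and its finite presentation\<close>

lemma hnn_data_br: "hnn_data Z_wr_Z br_endo"
  by (intro hnn_data.intro hnn_data_axioms.intro group_Z_wr_Z) auto

lemmas br_base_hom = hnn_data.hnn_base_hom[OF hnn_data_br, folded baumslag_remeslennikov_def]
  and br_stable_closed = hnn_data.hnn_stable_closed[OF hnn_data_br, folded baumslag_remeslennikov_def]
  and br_relation = hnn_data.hnn_relation[OF hnn_data_br, folded baumslag_remeslennikov_def]
  and generate_br = hnn_data.generate_hnn[OF hnn_data_br, folded baumslag_remeslennikov_def]
  and br_universal = hnn_data.hnn_universal[OF hnn_data_br, folded baumslag_remeslennikov_def]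

abbreviation "BR \<equiv> baumslag_remeslennikov"

text \<open>The second conjunct, combined with \<open>wr_model_inj\<close>, shows that the base
  embeds in the HNN extension; \<open>not_LERF_BR\<close> relies on this.\<close>

lemma br_generators_BR:
  "\<exists>\<phi>. br_generators BR (hnn_base Z_wr_Z br_endo (wr_a 0)) (hnn_base Z_wr_Z br_endo wr_s)
      (hnn_stable Z_wr_Z br_endo) \<phi> \<and> (\<forall>w. \<phi> (hnn_base Z_wr_Z br_endo w) = wr_model w)"
proof -
  let ?b = "hnn_base Z_wr_Z br_endo" and ?t = "hnn_stable Z_wr_Z br_endo"
  obtain \<phi> where \<phi>: "\<phi> \<in> hom BR affine_model"
    "\<And>w. w \<in> carrier Z_wr_Z \<Longrightarrow> \<phi> (?b w) = wr_model w" "\<phi> ?t = (0, 0, 1)"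
    using br_universal[OF group_affine_model wr_model_hom, of "(0, 0, 1)"] wr_model_br_endo by auto
  interpret G: group BR by (rule group_baumslag_remeslennikov)
  interpret b: group_hom Z_wr_Z BR ?b
    by (intro group_hom.intro group_hom_axioms.intro group_Z_wr_Z G.is_group br_base_hom)
  have t: "?t \<in> carrier BR"
    by (rule br_stable_closed)
  have rel: "G.conjugate ?t (?b w) = ?b (br_endo w)" for w
    using br_relation[of w] by (simp add: G.conjugate_def)
  have gens: "{?b (wr_a 0), ?b wr_s, ?t} \<subseteq> carrier BR" using t by auto
  interpret gen: subgroup "generate BR {?b (wr_a 0), ?b wr_s, ?t}" BR
    by (rule G.generate_is_subgroup[OF gens])
  \<comment> \<open>The base is generated by the images of \<open>wr_a 0\<close> and
    \<open>wr_s\<close>, so these and the stable letter generate everything.\<close>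
  have "range ?b = generate BR {?b (wr_a 0), ?b wr_s}"
    using b.generate_img[of "{wr_a 0, wr_s}"] by (simp add: generate_Z_wr_Z)
  also have "\<dots> \<subseteq> generate BR {?b (wr_a 0), ?b wr_s, ?t}"
    by (rule G.mono_generate) auto
  finally have "insert ?t (?b ` carrier Z_wr_Z) \<subseteq> generate BR {?b (wr_a 0), ?b wr_s, ?t}"
    by (auto intro: generate.incl)
  from G.generate_subgroup_incl[OF this gen.subgroup_axioms]
  have gen: "generate BR {?b (wr_a 0), ?b wr_s, ?t} = carrier BR"
    using gen.subset generate_br by auto
  have conj_s: "G.conjugate (?b wr_s) (?b (wr_a 0)) = ?b (wr_a 1)"
    using arg_cong[OF wr_conj[of 0], of ?b] by (simp add: G.conjugate_def)
  have "br_generators BR (?b (wr_a 0)) (?b wr_s) ?t \<phi>"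
  proof (intro br_generators.intro br_generators_axioms.intro G.is_group t gen \<phi>)
    show "?b wr_s \<otimes>\<^bsub>BR\<^esub> ?t = ?t \<otimes>\<^bsub>BR\<^esub> ?b wr_s"
      using rel[of wr_s] t G.conjugate_eq_iff[of ?t "?b wr_s"] by (simp add: br_endo_gens)
    show "G.conjugate ?t (?b (wr_a 0)) = ?b (wr_a 0) \<otimes>\<^bsub>BR\<^esub> G.conjugate (?b wr_s) (?b (wr_a 0))"
      using b.hom_mult[of "wr_a 0" "wr_a 1"] by (simp add: rel conj_s br_endo_gens)
    have "wr_a 0 \<otimes>\<^bsub>Z_wr_Z\<^esub> wr_a 1 = wr_a 1 \<otimes>\<^bsub>Z_wr_Z\<^esub> wr_a 0"
      by (simp add: wr_a_def add.commute)
    from arg_cong[OF this, of ?b]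
    show "?b (wr_a 0) \<otimes>\<^bsub>BR\<^esub> G.conjugate (?b wr_s) (?b (wr_a 0)) =
        G.conjugate (?b wr_s) (?b (wr_a 0)) \<otimes>\<^bsub>BR\<^esub> ?b (wr_a 0)"
      by (simp add: conj_s)
  qed (auto simp: \<phi> wr_model_def wr_a_def wr_s_def)
  with \<phi>(2) show ?thesis by auto
qed

lemma not_LERF_BR: "\<not> LERF BR"
proof -
  let ?b = "hnn_base Z_wr_Z br_endo" and ?t = "hnn_stable Z_wr_Z br_endo"
  obtain \<phi> where "br_generators BR (?b (wr_a 0)) (?b wr_s) ?t \<phi>" and \<phi>: "\<And>w. \<phi> (?b w) = wr_model w"
    using br_generators_BR by blast
  then interpret G: br_generators BR "?b (wr_a 0)" "?b wr_s" ?t \<phi> by simp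
  interpret b: group_hom Z_wr_Z BR ?b
    by (intro group_hom.intro group_hom_axioms.intro group_Z_wr_Z G.is_group br_base_hom)
  have rel: "G.conjugate ?t (?b w) = ?b (br_endo w)" for w
    using br_relation[of w] by (simp add: G.conjugate_def)
  have inj: "?b v = ?b w \<longleftrightarrow> v = w" for v w
    using \<phi> wr_model_inj by (metis injD)
  have gen: "generate BR {?b (wr_a 0), ?b wr_s} = range ?b"
    using b.generate_img[of "{wr_a 0, wr_s}"] by (simp add: generate_Z_wr_Z)
  obtain w where w: "w \<notin> range br_endo" using br_endo_not_surj by auto
  show ?thesis
  proof (rule G.not_LERF_if_strictly_ascending[where S = "{?b (wr_a 0), ?b wr_s}" and t = ?t and w = "?b w"])
    show "G.conjugate (inv\<^bsub>BR\<^esub> ?t) (?b w) \<notin> generate BR {?b (wr_a 0), ?b wr_s}"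
    proof
      assume "G.conjugate (inv\<^bsub>BR\<^esub> ?t) (?b w) \<in> generate BR {?b (wr_a 0), ?b wr_s}"
      then obtain v where v: "G.conjugate (inv\<^bsub>BR\<^esub> ?t) (?b w) = ?b v" unfolding gen by blast
      \<comment> \<open>Conjugating back by the stable letter would give
        \<open>w = br_endo v\<close>, against the choice of \<open>w\<close>.\<close>
      have "?b w = G.conjugate ?t (G.conjugate (inv\<^bsub>BR\<^esub> ?t) (?b w))"
        by (simp add: G.conjugate_conjugate)
      with w show False by (auto simp: v rel inj)
    qed
  qed (auto simp: gen rel)
qed

definition br_relators :: "(nat \<times> bool) list set" where
  "br_relators = (let F = free_group {0, 1, 2}; a = free_gen 0; s = free_gen 1; t = free_gen 2;
      b = s \<otimes>\<^bsub>F\<^esub> a \<otimes>\<^bsub>F\<^esub> inv\<^bsub>F\<^esub> s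
    in {s \<otimes>\<^bsub>F\<^esub> t \<otimes>\<^bsub>F\<^esub> inv\<^bsub>F\<^esub> (t \<otimes>\<^bsub>F\<^esub> s),
        t \<otimes>\<^bsub>F\<^esub> a \<otimes>\<^bsub>F\<^esub> inv\<^bsub>F\<^esub> t \<otimes>\<^bsub>F\<^esub> inv\<^bsub>F\<^esub> (a \<otimes>\<^bsub>F\<^esub> b),
        a \<otimes>\<^bsub>F\<^esub> b \<otimes>\<^bsub>F\<^esub> inv\<^bsub>F\<^esub> (b \<otimes>\<^bsub>F\<^esub> a)})"

text \<open>The relators are trivial at the three prescribed elements of
  \<open>affine_model\<close>, which yields \<open>\<phi>\<close>. The relations required by the
  locale are the relators with the inverse moved to the other side.\<close>

lemma br_generators_presented:
  defines "X \<equiv> {0, 1, 2 :: nat}"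
  defines "g \<equiv> presented_gen X br_relators"
  shows "br_relators \<subseteq> carrier (free_group X)"
    and "\<exists>\<phi>. br_generators (presented_group X br_relators) (g 0) (g 1) (g 2) \<phi>"
proof -
  interpret F: group "free_group X" by (rule group_free_group)
  have fg: "free_gen 0 \<in> carrier (free_group X)" "free_gen (Suc 0) \<in> carrier (free_group X)"
    "free_gen 2 \<in> carrier (free_group X)"
    by (auto intro!: free_gen_carrier simp: X_def)
  let ?F = "free_group X" and ?a = "free_gen 0" and ?s = "free_gen 1" and ?t = "free_gen 2"
  let ?c = "?s \<otimes>\<^bsub>?F\<^esub> ?a \<otimes>\<^bsub>?F\<^esub> inv\<^bsub>?F\<^esub> ?s"
  have relators: "br_relators = {?s \<otimes>\<^bsub>?F\<^esub> ?t \<otimes>\<^bsub>?F\<^esub> inv\<^bsub>?F\<^esub> (?t \<otimes>\<^bsub>?F\<^esub> ?s),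
      ?t \<otimes>\<^bsub>?F\<^esub> ?a \<otimes>\<^bsub>?F\<^esub> inv\<^bsub>?F\<^esub> ?t \<otimes>\<^bsub>?F\<^esub> inv\<^bsub>?F\<^esub> (?a \<otimes>\<^bsub>?F\<^esub> ?c),
      ?a \<otimes>\<^bsub>?F\<^esub> ?c \<otimes>\<^bsub>?F\<^esub> inv\<^bsub>?F\<^esub> (?c \<otimes>\<^bsub>?F\<^esub> ?a)}" (is "_ = {?r1, ?r2, ?r3}")
    unfolding br_relators_def Let_def X_def[symmetric] ..
  show R: "br_relators \<subseteq> carrier (free_group X)"
    unfolding relators using fg by simp
  have mem: "?r1 \<in> br_relators" "?r2 \<in> br_relators" "?r3 \<in> br_relators"
    unfolding relators by simp_all
  let ?P = "presented_group X br_relators"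
  interpret q: group_hom "free_group X" ?P
    "\<lambda>w. normal_closure (free_group X) br_relators #>\<^bsub>free_group X\<^esub> w"
    by (rule presented_group_hom[OF R])
  have q: "normal_closure (free_group X) br_relators #>\<^bsub>free_group X\<^esub> free_gen x = g x" for x
    by (simp add: g_def presented_gen_def)
  have gc: "g 0 \<in> carrier ?P" "g (Suc 0) \<in> carrier ?P" "g 2 \<in> carrier ?P"
    by (auto intro!: presented_gen_carrier simp: X_def g_def)
  let ?b = "g 1 \<otimes>\<^bsub>?P\<^esub> g 0 \<otimes>\<^bsub>?P\<^esub> inv\<^bsub>?P\<^esub> g 1"
  have rels: "g 1 \<otimes>\<^bsub>?P\<^esub> g 2 \<otimes>\<^bsub>?P\<^esub> inv\<^bsub>?P\<^esub> (g 2 \<otimes>\<^bsub>?P\<^esub> g 1) = \<one>\<^bsub>?P\<^esub>"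
    "g 2 \<otimes>\<^bsub>?P\<^esub> g 0 \<otimes>\<^bsub>?P\<^esub> inv\<^bsub>?P\<^esub> g 2 \<otimes>\<^bsub>?P\<^esub> inv\<^bsub>?P\<^esub> (g 0 \<otimes>\<^bsub>?P\<^esub> ?b) = \<one>\<^bsub>?P\<^esub>"
    "g 0 \<otimes>\<^bsub>?P\<^esub> ?b \<otimes>\<^bsub>?P\<^esub> inv\<^bsub>?P\<^esub> (?b \<otimes>\<^bsub>?P\<^esub> g 0) = \<one>\<^bsub>?P\<^esub>"
    using presented_group_relator[OF R mem(1)] presented_group_relator[OF R mem(2)]
      presented_group_relator[OF R mem(3)] fg
    by (simp_all add: q)
  define f where "f = (\<lambda>x::nat. if x = 0 then (1, 0, 0) else if x = 1 then (0, 1, 0) else (0, 0, 1) :: ratfun \<times> int \<times> int)"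
  have "h r = \<one>\<^bsub>affine_model\<^esub>"
    if "group_hom (free_group X) affine_model h" and h: "\<And>x. x \<in> X \<Longrightarrow> h (free_gen x) = f x"
      and r: "r \<in> br_relators" for h r
  proof -
    interpret h: group_hom "free_group X" affine_model h by fact
    have "h (free_gen 0) = (1, 0, 0)" "h (free_gen (Suc 0)) = (0, 1, 0)" "h (free_gen 2) = (0, 0, 1)"
      by (simp_all add: h X_def f_def)
    with r fg show ?thesis unfolding relators by auto
  qed
  then obtain \<phi> where \<phi>: "\<phi> \<in> hom ?P affine_model" "\<And>x. x \<in> X \<Longrightarrow> \<phi> (g x) = f x"
    using group.presented_group_universal[OF group_affine_model R, of f] unfolding g_def by auto
  have "br_generators ?P (g 0) (g 1) (g 2) \<phi>"
  proof (intro br_generators.intro br_generators_axioms.intro q.H.is_group \<phi>)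
    show "generate ?P {g 0, g 1, g 2} = carrier ?P"
      using generate_presented_group[OF R] by (simp add: g_def X_def)
    show "g 1 \<otimes>\<^bsub>?P\<^esub> g 2 = g 2 \<otimes>\<^bsub>?P\<^esub> g 1"
      using rels(1) gc by (simp add: q.H.inv_solve_right')
    show "q.H.conjugate (g 2) (g 0) = g 0 \<otimes>\<^bsub>?P\<^esub> q.H.conjugate (g 1) (g 0)"
      using rels(2) gc by (simp add: q.H.inv_solve_right' q.H.conjugate_def)
    show "g 0 \<otimes>\<^bsub>?P\<^esub> q.H.conjugate (g 1) (g 0) = q.H.conjugate (g 1) (g 0) \<otimes>\<^bsub>?P\<^esub> g 0"
      using rels(3) gc by (simp add: q.H.inv_solve_right' q.H.conjugate_def)
  qed (use gc \<phi>(2) in \<open>auto simp: f_def X_def\<close>)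
  then show "\<exists>\<phi>. br_generators ?P (g 0) (g 1) (g 2) \<phi>" by blast
qed

text \<open>By \<open>iso_model\<close> the HNN extension and the group with three relators are both
  isomorphic to the same subgroup of \<open>affine_model\<close>.\<close>

lemma finitely_presented_BR: "finitely_presented BR"
proof -
  let ?X = "{0, 1, 2 :: nat}"
  obtain \<phi> where "br_generators BR (hnn_base Z_wr_Z br_endo (wr_a 0)) (hnn_base Z_wr_Z br_endo wr_s)
      (hnn_stable Z_wr_Z br_endo) \<phi>"
    using br_generators_BR by blast
  note G = br_generators.iso_model[OF this]
  obtain \<psi> where P: "br_generators (presented_group ?X br_relators) (presented_gen ?X br_relators 0)
      (presented_gen ?X br_relators 1) (presented_gen ?X br_relators 2) \<psi>"
    using br_generators_presented(2) by blast
  have "BR \<cong> presented_group ?X br_relators"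
    using G group.iso_sym[OF _ br_generators.iso_model[OF P]] br_generators.axioms(1)[OF P]
    by (meson iso_trans)
  then show ?thesis
    unfolding finitely_presented_def
    using br_generators_presented(1)
    by (intro exI[of _ ?X] exI[of _ br_relators]) (auto simp: br_relators_def Let_def)
qed

theorem corollary2p4:
  shows "finitely_presented baumslag_remeslennikov \<and> solvable baumslag_remeslennikov \<and>
    \<not> LERF baumslag_remeslennikov \<and>
    \<not> contains_strictly_ascending_hnn_of_polycyclic baumslag_remeslennikov"
proof -
  obtain \<phi> where "br_generators BR (hnn_base Z_wr_Z br_endo (wr_a 0)) (hnn_base Z_wr_Z br_endo wr_s)
      (hnn_stable Z_wr_Z br_endo) \<phi>"
    using br_generators_BR by blast
  then interpret br_generators BR "hnn_base Z_wr_Z br_endo (wr_a 0)" "hnn_base Z_wr_Z br_endo wr_s"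
    "hnn_stable Z_wr_Z br_endo" \<phi> .
  show ?thesis
    using finitely_presented_BR solvable not_LERF_BR not_contains_ascending_hnn_of_polycyclic by simp
qed

end
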